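(* Let $(\omega,c)\in\mathbb{R}^2$ and consider the equation $$\omega\varphi-\partial_x^2\varphi-\frac{3}{16}|\varphi|^4\varphi=-ic\,\partial_x\varphi+\frac12 i|\varphi|^2\partial_x\varphi-\frac12 i\varphi^2\partial_x\overline{\varphi}\qquad(\ast)$$ for $\varphi\in H^1(\mathbb{R},\mathbb{C})$. Define $$\phi_{\omega,c}(x)=\begin{cases}\left[\dfrac{\sqrt{\omega}}{4\omega-c^2}\left\{\cosh\big(\sqrt{4\omega-c^2}\,x\big)-\dfrac{c}{2\sqrt{\omega}}\right\}\right]^{-1/2}, & 4\omega>c^2,\\[2mm] 2\sqrt{c}\,\left(c^2x^2+1\right)^{-1/2}, & 4\omega=c^2,\ c>0.\end{cases}$$ Then: (1) (Subcritical case) If $4\omega>c^2$, then $\varphi_{\omega,c}(x)=e^{i\frac{c}{2}x}\phi_{\omega,c}(x)$ is the unique nontrivial solution of $(\ast)$ in $H^1(\mathbb{R},\mathbb{C})$, up to the phase rotation and spatial translation symmetries of $(\ast)$. (2) (Critical case) If $4\omega=c^2$ and $c>0$, then $\varphi_{\omega,c}(x)=e^{i\frac{c}{2}x}\phi_{\omega,c}(x)$ is the unique nontrivial solution of $(\ast)$ in $H^1(\mathbb{R},\mathbb{C})$, up to the phase rotation and spatial translation symmetries of $(\ast)$. (3) If $4\omega=c^2$ and $c\le 0$, or if $4\omega<c^2$, then $(\ast)$ has no nontrivial solution in $H^1(\mathbb{R},\mathbb{C})$.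
   Context: Solutions in $H^1(\mathbb{R},\mathbb{C})$ are understood in the sense of distributions; nontrivial means not identically zero. "Unique up to the phase rotation and spatial translation symmetries" means that $\varphi_{\omega,c}$ is a solution and that every nontrivial solution $\varphi\in H^1(\mathbb{R},\mathbb{C})$ has the form $\varphi(x)=e^{i\theta}\varphi_{\omega,c}(x-x_0)$ for some $\theta,x_0\in\mathbb{R}$. Equation $(\ast)$ is the equation satisfied by the profile of a solitary wave $u(t,x)=e^{i\omega t}\varphi(x-ct)$ of the derivative nonlinear Schrödinger equation $i\partial_t u+\partial_x^2u+\frac12 i|u|^2\partial_xu-\frac12 iu^2\partial_x\overline{u}+\frac{3}{16}|u|^4u=0$. *)

theory Defs
  imports "HOL-Analysis.Analysis"
begin

definition vderiv :: "(real \<Rightarrow> complex) \<Rightarrow> real \<Rightarrow> complex" where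
  "vderiv f x = vector_derivative f (at x)"

(* C_c^infinity(R, C); the derivatives are those with respect to the real variable. *)
definition test_functions :: "(real \<Rightarrow> complex) set" where
  "test_functions =
     {\<psi>. (\<forall>n x. ((vderiv ^^ n) \<psi>) differentiable (at x)) \<and> compact (closure {x. \<psi> x \<noteq> 0})}"

(* Elements of L^2 and H^1 are represented by functions; identities between them are therefore
   meant almost everywhere. *)
definition L2 :: "(real \<Rightarrow> complex) set" where
  "L2 = {f. f \<in> borel_measurable lebesgue \<and> integrable lebesgue (\<lambda>x. (cmod (f x))\<^sup>2)}"

(* The bilinear pairing <f, psi> of the regular distribution given by a locally integrable f. *)
definition distr :: "(real \<Rightarrow> complex) \<Rightarrow> (real \<Rightarrow> complex) \<Rightarrow> complex" where
  "distr f \<psi> = (LINT x|lebesgue. f x * \<psi> x)"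

definition has_weak_derivative :: "(real \<Rightarrow> complex) \<Rightarrow> (real \<Rightarrow> complex) \<Rightarrow> bool" where
  "has_weak_derivative f g \<longleftrightarrow> (\<forall>\<psi>\<in>test_functions. distr g \<psi> = - distr f (vderiv \<psi>))"

definition H1 :: "(real \<Rightarrow> complex) set" where
  "H1 = {f \<in> L2. \<exists>g\<in>L2. has_weak_derivative f g}"

(* Here g is the weak derivative of \<phi>, which is unique almost everywhere, and the second
   derivative of \<phi> is the distribution \<psi> \<mapsto> <\<phi>, \<psi>''>. For \<phi> in H^1 all the
   densities below are locally integrable, because H^1(R) embeds into L^infinity. *)
definition dnls_profile_solution :: "real \<Rightarrow> real \<Rightarrow> (real \<Rightarrow> complex) \<Rightarrow> bool" where
  "dnls_profile_solution \<omega> c \<phi> \<longleftrightarrow>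
     \<phi> \<in> H1 \<and>
     (\<exists>g\<in>L2. has_weak_derivative \<phi> g \<and>
       (\<forall>\<psi>\<in>test_functions.
          distr (\<lambda>x. of_real \<omega> * \<phi> x) \<psi>
          - distr \<phi> (vderiv (vderiv \<psi>))
          - distr (\<lambda>x. 3 / 16 * of_real (cmod (\<phi> x) ^ 4) * \<phi> x) \<psi>
          = distr (\<lambda>x. - \<i> * of_real c * g x
                       + 1 / 2 * \<i> * of_real ((cmod (\<phi> x))\<^sup>2) * g x
                       - 1 / 2 * \<i> * (\<phi> x)\<^sup>2 * cnj (g x)) \<psi>))"

definition nontrivial_solution :: "real \<Rightarrow> real \<Rightarrow> (real \<Rightarrow> complex) \<Rightarrow> bool" where
  "nontrivial_solution \<omega> c \<phi> \<longleftrightarrow>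
     dnls_profile_solution \<omega> c \<phi> \<and> \<not> (AE x in lebesgue. \<phi> x = 0)"

(* The value 0 outside the two parameter regimes is a dummy. *)
definition amplitude :: "real \<Rightarrow> real \<Rightarrow> real \<Rightarrow> real" where
  "amplitude \<omega> c x =
     (if 4 * \<omega> > c\<^sup>2 then
        (sqrt \<omega> / (4 * \<omega> - c\<^sup>2) *
           (cosh (sqrt (4 * \<omega> - c\<^sup>2) * x) - c / (2 * sqrt \<omega>))) powr (- 1 / 2)
      else if 4 * \<omega> = c\<^sup>2 \<and> c > 0 then
        2 * sqrt c * (c\<^sup>2 * x\<^sup>2 + 1) powr (- 1 / 2)
      else 0)"

definition soliton :: "real \<Rightarrow> real \<Rightarrow> real \<Rightarrow> complex" where
  "soliton \<omega> c x = exp (\<i> * of_real (c / 2 * x)) * of_real (amplitude \<omega> c x)"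

definition unique_up_to_symmetries :: "real \<Rightarrow> real \<Rightarrow> (real \<Rightarrow> complex) \<Rightarrow> bool" where
  "unique_up_to_symmetries \<omega> c \<phi>0 \<longleftrightarrow>
     nontrivial_solution \<omega> c \<phi>0 \<and>
     (\<forall>\<phi>. nontrivial_solution \<omega> c \<phi> \<longrightarrow>
        (\<exists>\<theta> x0 :: real. AE x in lebesgue. \<phi> x = exp (\<i> * of_real \<theta>) * \<phi>0 (x - x0)))"

end

(*
  On the line, weak derivatives in L^1_loc are integrals of continuous primitives, so every H^1
  solution is almost everywhere a classical C^2 solution.  The gauge h = exp(-i c x/2) phi turns the
  equation into h'' = Q(|h|^2) h + Im(cnj h h') h with a real coefficient.  The momentum Im(cnj h h')
  is then constant, hence zero by integrability, and the energy integral vanishes for the same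
  reason: |h'|^2 = s (omega - c^2/4 + c s/4 - s^2/16) with s = |h|^2.  Consequently h has constant
  phase, s vanishes nowhere unless identically, and w = 1/s solves the linear equation
  w'' = (4 omega - c^2) w + c/2 with first integral w'^2 = (4 omega - c^2) w^2 + c w - 1/4.  In the
  soliton regimes this determines w up to translation; in the others the right-hand side of the
  energy identity is negative for small s > 0, which s must attain because it is integrable.
*)

theory Submission
  imports Defs "HOL-Probability.Sinc_Integral"
begin

section \<open>Test functions\<close>

text \<open>The derivative nonlinearity is milder than it looks: with \<open>cnj\<close> for
  conjugation, i/2 (|\<phi>|^2 \<phi>' - \<phi>^2 cnj \<phi>') = - Im(cnj \<phi> \<phi>') \<phi>, a
  real multiple of \<phi>. The gauge then only has to remove the linear term with c. Integrability
  enters through one fact: |h|^2 + |h'|^2 is integrable over the line, so it takes arbitrarily small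
  values. A conserved quantity that is dominated by it at such points must be zero, and no limit at
  infinity has to be established. The energy identity alone reads s'^2 = 4 s^2 P(s). It does not
  determine s: at a zero of P uniqueness for the first-order equation breaks down, and the soliton
  has such a point at its crest. Passing to w = 1/s turns s^2 P(s) into a quadratic polynomial in w,
  and the second-order equation for w is linear, so uniqueness there is elementary. The first
  integral keeps a second task: it fixes the value of w at a point where w' is known, because its
  constant term -1/4 leaves room for one positive root only.\<close>

definition k_diff :: "nat \<Rightarrow> (real \<Rightarrow> complex) \<Rightarrow> bool" where
  "k_diff n f \<longleftrightarrow> (\<forall>k<n. \<forall>x. ((vderiv ^^ k) f) differentiable (at x))"

lemma vderiv_eqI:
  assumes "\<And>x. (f has_vector_derivative f' x) (at x)"
  shows "vderiv f = f'"
  using assms by (auto simp: vderiv_def fun_eq_iff vector_derivative_at)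

lemma has_vderiv:
  assumes "f differentiable (at x)"
  shows "(f has_vector_derivative vderiv f x) (at x)"
  using assms by (simp add: vderiv_def vector_derivative_works[symmetric])

lemma k_diff_0 [simp]: "k_diff 0 f"
  by (simp add: k_diff_def)

text \<open>Counting derivatives up to \<open>n\<close> turns smoothness of products and affine
  substitutions into inductions: the derivative of a product consists of products of functions of
  order \<open>n\<close> again.\<close>

lemma k_diff_Suc: "k_diff (Suc n) f \<longleftrightarrow> (\<forall>x. f differentiable (at x)) \<and> k_diff n (vderiv f)"
  by (auto simp: k_diff_def less_Suc_eq_0_disj funpow_swap1)

lemma k_diff_SucI:
  assumes "\<And>x. (f has_vector_derivative f' x) (at x)" "k_diff n f'"
  shows "k_diff (Suc n) f"
  using assms by (auto simp: k_diff_Suc vderiv_eqI[OF assms(1)] intro: differentiableI_vector)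

lemma k_diff_SucD:
  assumes "k_diff (Suc n) f"
  shows "(f has_vector_derivative vderiv f x) (at x)" "k_diff n (vderiv f)" "k_diff n f"
  using assms by (simp add: k_diff_Suc has_vderiv, simp add: k_diff_Suc, simp add: k_diff_def)

lemma k_diff_const [simp]: "k_diff n (\<lambda>x. a)"
  by (induction n arbitrary: a) (auto intro!: k_diff_SucI derivative_eq_intros)

lemma k_diff_add: "k_diff n f \<Longrightarrow> k_diff n g \<Longrightarrow> k_diff n (\<lambda>x. f x + g x)"
proof (induction n arbitrary: f g)
  case (Suc n)
  note f = k_diff_SucD[OF Suc.prems(1)] and g = k_diff_SucD[OF Suc.prems(2)]
  show ?case
    by (rule k_diff_SucI[OF has_vector_derivative_add[OF f(1) g(1)]]) (rule Suc.IH[OF f(2) g(2)])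
qed simp

lemma k_diff_mult: "k_diff n f \<Longrightarrow> k_diff n g \<Longrightarrow> k_diff n (\<lambda>x. f x * g x)"
proof (induction n arbitrary: f g)
  case (Suc n)
  note f = k_diff_SucD[OF Suc.prems(1)] and g = k_diff_SucD[OF Suc.prems(2)]
  show ?case
    by (rule k_diff_SucI[OF has_vector_derivative_mult[OF f(1) g(1)]])
      (rule k_diff_add[OF Suc.IH[OF f(3) g(2)] Suc.IH[OF f(2) g(3)]])
qed simp

lemma k_diff_affine: "k_diff n f \<Longrightarrow> k_diff n (\<lambda>x. f (p * x + q))"
proof (induction n arbitrary: f)
  case (Suc n)
  note f = k_diff_SucD[OF Suc.prems]
  have "((\<lambda>x. f (p * x + q)) has_vector_derivative of_real p * vderiv f (p * x + q)) (at x)" for x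
  proof -
    have "((\<lambda>x. p * x + q) has_vector_derivative p) (at x)"
      by (auto intro!: derivative_eq_intros)
    from vector_diff_chain_at[OF this f(1)] show ?thesis
      by (simp add: comp_def scaleR_conv_of_real)
  qed
  then show ?case
    by (rule k_diff_SucI) (rule k_diff_mult[OF k_diff_const Suc.IH[OF f(2)]])
qed simp

text \<open>Functions of this form are closed under differentiation, so that $e^{-1/x}$, extended by $0$, is smooth.\<close>

definition flat :: "real poly \<Rightarrow> real \<Rightarrow> complex" where
  "flat p x = (if x > 0 then of_real (poly p (1 / x) * exp (- (1 / x))) else 0)"

lemma poly_div_exp_tendsto_0: "((\<lambda>t::real. poly p t * exp (- t)) \<longlongrightarrow> 0) at_top"
proof -
  \<comment> \<open>The extra factor \<open>t ^ k\<close> absorbs the t that \<open>pCons\<close>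
    puts in front of its tail, so the induction hypothesis applies at \<open>Suc k\<close>.\<close>
  have "((\<lambda>t::real. t ^ k * poly p t * exp (- t)) \<longlongrightarrow> 0) at_top" for k
  proof (induction p arbitrary: k)
    case (pCons a p)
    have "((\<lambda>t::real. a * (t ^ k / exp t) + t ^ Suc k * poly p t * exp (- t)) \<longlongrightarrow> a * 0 + 0) at_top"
      by (intro tendsto_intros tendsto_power_div_exp_0 pCons.IH)
    then show ?case by (simp add: algebra_simps exp_minus divide_inverse)
  qed simp
  from this[of 0] show ?thesis by simp
qed

lemma flat_tendsto_0: "(flat p \<longlongrightarrow> 0) (at 0)"
proof -
  have "((\<lambda>x. poly p (inverse x) * exp (- inverse x)) \<longlongrightarrow> 0) (at_right 0)"
    by (rule filterlim_compose[OF poly_div_exp_tendsto_0 filterlim_inverse_at_top_right])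
  then have "((\<lambda>x. complex_of_real (poly p (inverse x) * exp (- inverse x))) \<longlongrightarrow> 0) (at_right 0)"
    by (subst of_real_0[symmetric], rule tendsto_of_real)
  then have "(flat p \<longlongrightarrow> 0) (at_right 0)"
    by (rule Lim_transform_eventually) 
      (auto simp: flat_def eventually_at_right_field inverse_eq_divide intro!: exI[of _ 1])
  moreover have "(flat p \<longlongrightarrow> 0) (at_left 0)"
    by (rule Lim_transform_eventually[OF tendsto_const]) 
      (auto simp: flat_def eventually_at_left_field intro!: exI[of _ "-1"])
  ultimately show ?thesis by (simp add: filterlim_split_at)
qed

text \<open>With t = 1/x one has t' = - t^2, so p(t) exp(-t) differentiates to t^2 (p - p')(t)
  exp(-t); \<open>[:0, 0, 1:]\<close> is t^2. Only the origin needs a limit.\<close>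

lemma flat_derivative:
  "(flat p has_vector_derivative flat ([:0, 0, 1:] * (p - pderiv p)) x) (at x)"
proof -
  consider "x < 0" | "x = 0" | "x > 0" by linarith
  then show ?thesis
  proof cases
    case 1
    have "((\<lambda>_. 0) has_vector_derivative (0::complex)) (at x)"
      by (auto intro!: derivative_eq_intros)
    then have "(flat p has_vector_derivative 0) (at x)"
      by (rule has_vector_derivative_transform_within_open[where S="{..<0}"]) (use 1 in \<open>auto simp: flat_def\<close>)
    with 1 show ?thesis by (simp add: flat_def)
  next
    case 2
    \<comment> \<open>Dividing by y > 0 multiplies p by t = 1/y, so the difference quotient at 0 is
      itself of the form \<open>flat\<close>.\<close>
    have "((\<lambda>y. norm (flat ([:0,1:] * p) y)) \<longlongrightarrow> 0) (at 0)"
      by (rule tendsto_norm_zero[OF flat_tendsto_0])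
    then have "((\<lambda>y. norm (flat p y) / norm y) \<longlongrightarrow> 0) (at 0)"
      by (rule Lim_transform_eventually)
        (auto simp: flat_def eventually_at_filter norm_mult norm_divide divide_simps)
    then have "(flat p has_vector_derivative 0) (at 0)"
      by (simp add: has_vector_derivative_def has_derivative_at flat_def[of p 0])
    with 2 show ?thesis by (simp add: flat_def)
  next
    case 3
    have "((\<lambda>x. poly p (1 / x) * exp (- (1 / x))) has_real_derivative
        (poly ([:0, 0, 1:] * (p - pderiv p)) (1 / x) * exp (- (1 / x)))) (at x)"
    proof -
      have 1: "((\<lambda>x. poly p (1 / x)) has_real_derivative poly (pderiv p) (1 / x) * (- (1 / x\<^sup>2))) (at x)"
        by (rule DERIV_chain2[OF poly_DERIV]) (use 3 in \<open>auto intro!: derivative_eq_intros simp: power2_eq_square\<close>)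
      have 2: "((\<lambda>x. exp (- (1 / x))) has_real_derivative exp (- (1 / x)) * (1 / x\<^sup>2)) (at x)"
        using 3 by (auto intro!: derivative_eq_intros simp: power2_eq_square)
      show ?thesis
        by (rule DERIV_cong[OF DERIV_mult[OF 1 2]]) (simp add: algebra_simps power2_eq_square)
    qed
    then have "((\<lambda>x. complex_of_real (poly p (1 / x) * exp (- (1 / x)))) has_vector_derivative
        (of_real (poly ([:0, 0, 1:] * (p - pderiv p)) (1 / x) * exp (- (1 / x))))) (at x)"
      by (intro has_vector_derivative_of_real) (simp add: has_real_derivative_iff_has_vector_derivative)
    then have "(flat p has_vector_derivative (of_real (poly ([:0, 0, 1:] * (p - pderiv p)) (1 / x) * exp (- (1 / x))))) (at x)"
      by (rule has_vector_derivative_transform_within_open[where S="{0<..}"]) (use 3 in \<open>auto simp: flat_def\<close>)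
    with 3 show ?thesis by (simp add: flat_def)
  qed
qed

lemma k_diff_flat: "k_diff n (flat p)"
  by (induction n arbitrary: p) (auto intro: k_diff_SucI flat_derivative)

section \<open>Test functions as smooth functions with bounded support, and bumps\<close>

lemma test_functions_alt:
  "\<psi> \<in> test_functions \<longleftrightarrow> (\<forall>n. k_diff n \<psi>) \<and> (\<exists>R\<ge>0. \<forall>x. R < \<bar>x\<bar> \<longrightarrow> \<psi> x = 0)"
proof -
  have "compact (closure {x. \<psi> x \<noteq> 0}) \<longleftrightarrow> bounded {x. \<psi> x \<noteq> 0}"
    using bounded_closure bounded_subset[OF _ closure_subset] by (auto simp: compact_eq_bounded_closed)
  also have "\<dots> \<longleftrightarrow> (\<exists>R. \<forall>x. R < \<bar>x\<bar> \<longrightarrow> \<psi> x = 0)"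
    unfolding bounded_iff by (force simp: not_le[symmetric])
  also have "\<dots> \<longleftrightarrow> (\<exists>R\<ge>0. \<forall>x. R < \<bar>x\<bar> \<longrightarrow> \<psi> x = 0)"
  proof safe
    fix R assume "\<forall>x. R < \<bar>x\<bar> \<longrightarrow> \<psi> x = 0"
    then show "\<exists>R\<ge>0. \<forall>x. R < \<bar>x\<bar> \<longrightarrow> \<psi> x = 0"
      by (intro exI[of _ "max R 0"]) simp
  qed auto
  finally show ?thesis
    by (auto simp: test_functions_def k_diff_def)
qed

lemma test_function_derivative:
  assumes "\<psi> \<in> test_functions"
  shows "(\<psi> has_vector_derivative vderiv \<psi> x) (at x)"
  using assms k_diff_SucD(1)[of 0 \<psi>] by (auto simp: test_functions_alt)

lemma test_function_vderiv:
  assumes "\<psi> \<in> test_functions"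
  shows "vderiv \<psi> \<in> test_functions"
proof -
  obtain R where R: "R \<ge> 0" "\<And>x. R < \<bar>x\<bar> \<Longrightarrow> \<psi> x = 0" 
    using assms by (auto simp: test_functions_alt)
  have "vderiv \<psi> x = 0" if "R < \<bar>x\<bar>" for x
  proof -
    have "((\<lambda>_. 0) has_vector_derivative (0::complex)) (at x)"
      by (auto intro!: derivative_eq_intros)
    then have "(\<psi> has_vector_derivative 0) (at x)"
      by (rule has_vector_derivative_transform_within_open[where S="{x. R < \<bar>x\<bar>}"]) 
        (use that R in \<open>auto intro!: open_Collect_less continuous_intros\<close>)
    then show ?thesis by (simp add: vderiv_def vector_derivative_at)
  qed
  moreover have "k_diff n (vderiv \<psi>)" for n
    using assms k_diff_Suc[of n \<psi>] unfolding test_functions_alt by blast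
  ultimately show ?thesis
    using R(1) by (auto simp: test_functions_alt)
qed

lemma test_function_isCont: "\<psi> \<in> test_functions \<Longrightarrow> isCont \<psi> x"
  using test_function_derivative has_vector_derivative_continuous by blast

lemma test_function_continuous: "\<psi> \<in> test_functions \<Longrightarrow> continuous_on S \<psi>"
  by (simp add: continuous_at_imp_continuous_on test_function_isCont)

lemma test_function_measurable [measurable_dest]: 
  "\<psi> \<in> test_functions \<Longrightarrow> \<psi> \<in> borel_measurable borel"
  by (intro borel_measurable_continuous_onI test_function_continuous)

lemma test_function_diff:
  assumes "\<psi> \<in> test_functions" "\<eta> \<in> test_functions"
  shows "(\<lambda>x. \<psi> x - a * \<eta> x) \<in> test_functions"
proof -
  obtain R S where "R \<ge> 0" "\<And>x. R < \<bar>x\<bar> \<Longrightarrow> \<psi> x = 0" "S \<ge> 0" "\<And>x. S < \<bar>x\<bar> \<Longrightarrow> \<eta> x = 0"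
    using assms by (auto simp: test_functions_alt)
  moreover have "k_diff n (\<lambda>x. \<psi> x + (- a) * \<eta> x)" for n
    using assms by (intro k_diff_add k_diff_mult) (auto simp: test_functions_alt)
  ultimately show ?thesis
    by (auto simp: test_functions_alt intro!: exI[of _ "max R S"])
qed

lemma test_function_bounded:
  assumes "\<psi> \<in> test_functions"
  obtains R B where "R \<ge> 0" "B \<ge> 0" "\<And>x. R < \<bar>x\<bar> \<Longrightarrow> \<psi> x = 0" "\<And>x. norm (\<psi> x) \<le> B"
    "\<And>x. norm (\<psi> x) \<le> B * indicator {-R..R} x"
proof -
  obtain R where R: "R \<ge> 0" "\<And>x. R < \<bar>x\<bar> \<Longrightarrow> \<psi> x = 0" 
    using assms by (auto simp: test_functions_alt)
  have "bounded (\<psi> ` {-R..R})"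
    using assms by (intro compact_imp_bounded compact_continuous_image test_function_continuous) auto
  then obtain B where B: "\<And>x. x \<in> {-R..R} \<Longrightarrow> norm (\<psi> x) \<le> B" "B \<ge> 0"
    by (metis bounded_pos imageI less_imp_le)
  have "norm (\<psi> x) \<le> B * indicator {-R..R} x" for x
    using R B(1)[of x] by (auto simp: indicator_def)
  moreover have "norm (\<psi> x) \<le> B" for x
    using R B(1)[of x] B(2) by (cases "R < \<bar>x\<bar>") (auto simp: abs_le_iff not_less)
  ultimately show ?thesis using that R B by blast
qed

text \<open>The bumps increase to the indicator of the open interval from $a$ to $b$ as $n$ tends to infinity.\<close>

definition cutoff :: "real \<Rightarrow> real \<Rightarrow> nat \<Rightarrow> real \<Rightarrow> complex" where
  "cutoff a b n x = flat 1 (real (Suc n) * (x - a)) * flat 1 (real (Suc n) * (b - x))"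

lemma cutoff_test_function: "cutoff a b n \<in> test_functions"
proof -
  have "k_diff k (\<lambda>x. flat 1 (real (Suc n) * x + (- real (Suc n) * a)) * flat 1 ((- real (Suc n)) * x + real (Suc n) * b))" for k
    by (intro k_diff_mult k_diff_affine k_diff_flat)
  then have "k_diff k (cutoff a b n)" for k
    by (simp add: cutoff_def[abs_def] algebra_simps)
  moreover have "cutoff a b n x = 0" if "max \<bar>a\<bar> \<bar>b\<bar> < \<bar>x\<bar>" for x
    using that by (auto simp: cutoff_def flat_def zero_less_mult_iff)
  ultimately show ?thesis
    by (auto simp: test_functions_alt intro!: exI[of _ "max \<bar>a\<bar> \<bar>b\<bar>"])
qed

lemma norm_cutoff_le: "norm (cutoff a b n x) \<le> indicator {a<..<b} x"
  by (auto simp: cutoff_def flat_def norm_mult zero_less_mult_iff indicator_def intro!: mult_le_one)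

lemma cutoff_tendsto: "(\<lambda>n. cutoff a b n x) \<longlonglongrightarrow> indicator {a<..<b} x"
proof (cases "a < x \<and> x < b")
  case True
  have "(\<lambda>n. exp (- (1 / (real (Suc n) * t)))) \<longlonglongrightarrow> exp (- (0 * (1 / t)))" for t :: real
  proof -
    have "(\<lambda>n. exp (- (1 / real (Suc n) * (1 / t)))) \<longlonglongrightarrow> exp (- (0 * (1 / t)))"
      by (intro tendsto_intros LIMSEQ_Suc[OF lim_1_over_n])
    then show ?thesis by simp
  qed
  then have "(\<lambda>n. complex_of_real (exp (- (1 / (real (Suc n) * (x - a))))) * of_real (exp (- (1 / (real (Suc n) * (b - x))))))
     \<longlonglongrightarrow> of_real (exp (- (0 * (1 / (x - a))))) * of_real (exp (- (0 * (1 / (b - x)))))"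
    by (intro tendsto_mult tendsto_of_real)
  with True show ?thesis by (simp add: cutoff_def flat_def)
next
  case False
  then show ?thesis by (auto simp: cutoff_def flat_def zero_less_mult_iff)
qed

section \<open>Weak derivatives on the line\<close>

text \<open>Borel measurability is built in so that Fubini and all later integrals can live on
  \<open>lborel\<close>; Lebesgue measurable functions enter only through Borel
  representatives.\<close>

definition locally_integrable :: "(real \<Rightarrow> complex) \<Rightarrow> bool" where
  "locally_integrable u \<longleftrightarrow> u \<in> borel_measurable borel \<and> (\<forall>a b. set_integrable lborel {a..b} u)"

lemma locally_integrable_measurable [measurable_dest]:
  "locally_integrable u \<Longrightarrow> u \<in> borel_measurable borel"
  by (simp add: locally_integrable_def)

lemma locally_integrable_continuous:
  "continuous_on UNIV u \<Longrightarrow> locally_integrable u"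
  unfolding locally_integrable_def
  by (auto intro!: borel_measurable_continuous_onI borel_integrable_atLeastAtMost' intro: continuous_on_subset)

lemma locally_integrable_diff:
  "locally_integrable u \<Longrightarrow> locally_integrable v \<Longrightarrow> locally_integrable (\<lambda>x. u x - v x)"
  unfolding locally_integrable_def by (auto intro: set_integral_diff)

lemma locally_integrable_times_test:
  assumes u: "locally_integrable u" and \<psi>: "\<psi> \<in> test_functions"
  shows "integrable lborel (\<lambda>x. u x * \<psi> x)"
proof -
  obtain R B where R: "B \<ge> 0" "\<And>x. norm (\<psi> x) \<le> B * indicator {-R..R} x" 
    using test_function_bounded[OF \<psi>] by metis
  have int: "integrable lborel (\<lambda>x. B *\<^sub>R (indicator {-R..R} x *\<^sub>R u x))"
    using u by (intro integrable_scaleR_right) (auto simp: locally_integrable_def set_integrable_def)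
  have [measurable]: "u \<in> borel_measurable borel" "\<psi> \<in> borel_measurable borel"
    using u \<psi> by measurable
  have "norm (u x * \<psi> x) \<le> norm (B *\<^sub>R (indicator {-R..R} x *\<^sub>R u x))" for x
    using mult_left_mono[OF R(2)[of x] norm_ge_zero[of "u x"]] R(1) by (simp add: norm_mult mult_ac)
  then show ?thesis
    by (intro Bochner_Integration.integrable_bound[OF int]) auto
qed

lemma test_function_integrable:
  "\<psi> \<in> test_functions \<Longrightarrow> integrable lborel \<psi>"
  using locally_integrable_times_test[OF locally_integrable_continuous[of "\<lambda>_. 1"]] by simp

section \<open>The fundamental lemma of the calculus of variations\<close>

text \<open>Open intervals are an intersection-stable generator of the Borel sets, so Dynkin's
  argument carries the vanishing integral to every Borel set; a function with all such integrals
  zero is zero almost everywhere.\<close>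

lemma AE_zero_if_interval_integrals_zero:
  fixes u :: "real \<Rightarrow> complex"
  assumes u: "integrable lborel u"
    and zero: "\<And>a b. (LINT x:{a<..<b}|lborel. u x) = 0"
  shows "AE x in lborel. u x = 0"
proof (rule sigma_finite_measure.density_zero[OF sigma_finite_lborel u])
  have si: "set_integrable lborel A u" if "A \<in> sets borel" for A
    using integrable_mult_indicator[OF _ u, of A] that by (simp add: set_integrable_def)
  \<comment> \<open>The complement case of the induction needs the integral over the whole line, a
    limit of integrals over growing intervals.\<close>
  have UNIV: "(LINT x|lborel. u x) = 0"
  proof -
    have "(\<lambda>n. LINT x|lborel. indicator {-real n<..<real n} x *\<^sub>R u x) \<longlonglongrightarrow> (LINT x|lborel. u x)"
    proof (rule integral_dominated_convergence[where w="\<lambda>x. norm (u x)"])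
      show "AE x in lborel. (\<lambda>n. indicator {-real n<..<real n} x *\<^sub>R u x) \<longlonglongrightarrow> u x"
      proof (rule AE_I2)
        fix x
        obtain N where N: "\<bar>x\<bar> < real N" using reals_Archimedean2 by blast
        have "\<forall>\<^sub>F n in sequentially. u x = indicator {-real n<..<real n} x *\<^sub>R u x"
          using eventually_ge_at_top[of N]
        proof eventually_elim
          case (elim n)
          then have "real N \<le> real n" by simp
          with N have "x \<in> {-real n<..<real n}" by auto
          then show ?case by simp
        qed
        then show "(\<lambda>n. indicator {-real n<..<real n} x *\<^sub>R u x) \<longlonglongrightarrow> u x"
          by (rule Lim_transform_eventually[OF tendsto_const])
      qed
    qed (use u in \<open>auto simp: indicator_def\<close>)
    moreover have "(LINT x|lborel. indicator {-real n<..<real n} x *\<^sub>R u x) = 0" for n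
      using zero[of "-real n" "real n"] by (simp add: set_lebesgue_integral_def)
    ultimately show ?thesis by (simp add: LIMSEQ_const_iff)
  qed
  fix A :: "real set" assume "A \<in> sets lborel"
  then have A: "A \<in> sigma_sets UNIV (range (\<lambda>(a, b). {a<..<b}))"
    by (simp add: borel_eq_box box_real[abs_def])
  have G: "Int_stable (range (\<lambda>(a, b). {a<..<b::real}))"
    unfolding Int_stable_def
  proof safe
    fix a b c d :: real
    show "{a<..<b} \<inter> {c<..<d} \<in> range (\<lambda>(a, b). {a<..<b})"
      by (rule image_eqI[where x="(max a c, min b d)"]) auto
  qed
  have cl: "range (\<lambda>(a, b). {a<..<b::real}) \<subseteq> Pow UNIV" by simp
  show "(LINT x:A|lborel. u x) = 0"
    using G cl A
  proof (induction rule: sigma_sets_induct_disjoint)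
    case (compl A)
    then have "A \<in> sets borel" by (simp add: borel_eq_box box_real[abs_def])
    with si[of A] have "(LINT x:UNIV - A|lborel. u x) = (LINT x|lborel. u x) - (LINT x:A|lborel. u x)"
      unfolding set_lebesgue_integral_def set_integrable_def
      by (subst Bochner_Integration.integral_diff[symmetric])
        (auto simp: u indicator_diff scaleR_diff_left)
    with compl UNIV show ?case by simp
  next
    case (union A)
    then have "A i \<in> sets borel" for i by (auto simp: borel_eq_box box_real[abs_def])
    with union show ?case
      by (subst lebesgue_integral_countable_add) (auto simp: disjoint_family_on_def intro!: si)
  next
    case empty
    show ?case by (simp add: set_lebesgue_integral_def)
  qed (use zero in auto)
qed

lemma cutoff_integral_tendsto:
  assumes u: "locally_integrable u"
  shows "(\<lambda>n. LINT x|lborel. u x * cutoff a b n x) \<longlonglongrightarrow> (LINT x:{a<..<b}|lborel. u x)"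
  unfolding set_lebesgue_integral_def
proof (rule integral_dominated_convergence[where w="\<lambda>x. norm (indicator {a..b} x *\<^sub>R u x)"])
  have [measurable]: "u \<in> borel_measurable borel" using u by measurable
  show "(\<lambda>x. indicator {a<..<b} x *\<^sub>R u x) \<in> borel_measurable lborel" by measurable
  show "(\<lambda>x. u x * cutoff a b n x) \<in> borel_measurable lborel" for n
    using test_function_measurable[OF cutoff_test_function] by measurable
  show "integrable lborel (\<lambda>x. norm (indicator {a..b} x *\<^sub>R u x))"
    using u by (intro integrable_norm) (auto simp: locally_integrable_def set_integrable_def)
  have "(\<lambda>n. u x * cutoff a b n x) \<longlonglongrightarrow> u x * indicator {a<..<b} x" for x
    by (intro tendsto_intros cutoff_tendsto)
  then show "AE x in lborel. (\<lambda>n. u x * cutoff a b n x) \<longlonglongrightarrow> indicator {a<..<b} x *\<^sub>R u x"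
    by (simp add: scaleR_conv_of_real mult.commute of_real_indicator)
  have "norm (u x * cutoff a b n x) \<le> norm (indicator {a..b} x *\<^sub>R u x)" for n x
    using mult_left_mono[OF norm_cutoff_le[of a b n x] norm_ge_zero[of "u x"]]
    using norm_cutoff_le[of a b n x] by (cases "a < x \<and> x < b") (auto simp: norm_mult indicator_def)
  then show "AE x in lborel. norm (u x * cutoff a b n x) \<le> norm (indicator {a..b} x *\<^sub>R u x)" for n
    by simp
qed

text \<open>Bumps filling an interval turn the hypothesis into zero integrals over all intervals.
  Truncation to (-n, n) makes \<open>u\<close> integrable, and countably many null sets are united
  at the end.\<close>

lemma fundamental_lemma:
  assumes u: "locally_integrable u"
    and zero: "\<And>\<psi>. \<psi> \<in> test_functions \<Longrightarrow> (LINT x|lborel. u x * \<psi> x) = 0"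
  shows "AE x in lborel. u x = 0"
proof -
  have int0: "(LINT x:{a<..<b}|lborel. u x) = 0" for a b
    using cutoff_integral_tendsto[OF u, of a b] zero[OF cutoff_test_function] by (simp add: LIMSEQ_const_iff)
  have "AE x in lborel. indicator {-real n<..<real n} x *\<^sub>R u x = 0" for n
  proof (rule AE_zero_if_interval_integrals_zero)
    have "set_integrable lborel {-real n<..<real n} u"
      by (rule set_integrable_subset[of _ "{-real n..real n}"]) (use u in \<open>auto simp: locally_integrable_def\<close>)
    then show "integrable lborel (\<lambda>x. indicator {-real n<..<real n} x *\<^sub>R u x)"
      by (simp add: set_integrable_def)
    fix a b
    have "(LINT x:{a<..<b}|lborel. indicator {-real n<..<real n} x *\<^sub>R u x)
       = (LINT x:{max a (-real n)<..<min b (real n)}|lborel. u x)"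
      unfolding set_lebesgue_integral_def 
      by (intro Bochner_Integration.integral_cong) (auto simp: indicator_def)
    then show "(LINT x:{a<..<b}|lborel. indicator {-real n<..<real n} x *\<^sub>R u x) = 0"
      by (simp add: int0)
  qed
  then have "AE x in lborel. \<forall>n::nat. indicator {-real n<..<real n} x *\<^sub>R u x = 0"
    by (subst AE_all_countable) blast
  then show ?thesis
  proof eventually_elim
    case (elim x)
    obtain N where "\<bar>x\<bar> < real N" using reals_Archimedean2 by blast
    then have "x \<in> {-real N<..<real N}" by auto
    with elim[rule_format, of N] show ?case by simp
  qed
qed

section \<open>Functions with vanishing weak derivative are constant\<close>

lemma continuous_antiderivative:
  fixes f :: "real \<Rightarrow> complex"
  assumes "continuous_on UNIV f"
  obtains F where "\<And>x. (F has_vector_derivative f x) (at x)"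
    "\<And>x y. x \<le> y \<Longrightarrow> (LINT t:{x..y}|lborel. f t) = F y - F x"
proof -
  obtain F where F: "\<And>x. (F has_vector_derivative f x) (at x)"
  proof -
    have "\<exists>F. \<forall>x. - \<infinity> < ereal x \<longrightarrow> ereal x < \<infinity> \<longrightarrow> (F has_vector_derivative f x) (at x)"
      by (rule einterval_antiderivative) (use assms in \<open>simp_all add: continuous_on_eq_continuous_at\<close>)
    with that show ?thesis by auto
  qed
  moreover have "(LINT t:{x..y}|lborel. f t) = F y - F x" if "x \<le> y" for x y
    unfolding set_lebesgue_integral_def using that
    by (intro integral_FTC_atLeastAtMost) (auto intro: has_vector_derivative_at_within[OF F] continuous_on_subset[OF assms])
  ultimately show ?thesis using that by blast
qed

lemma integral_outside_support:
  fixes f :: "real \<Rightarrow> complex"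
  assumes "\<And>x. x \<notin> {a..b} \<Longrightarrow> f x = 0"
  shows "(LINT x:{a..b}|lborel. f x) = (LINT x|lborel. f x)"
  unfolding set_lebesgue_integral_def
  by (intro Bochner_Integration.integral_cong) (use assms in \<open>auto simp: indicator_def\<close>)

text \<open>Any antiderivative is constant on either side of the support of \<open>\<eta>\<close>.
  The zero mean makes the two constants agree, and subtracting their common value leaves bounded
  support.\<close>

lemma test_function_antiderivative:
  assumes \<eta>: "\<eta> \<in> test_functions" and zero: "(LINT x|lborel. \<eta> x) = 0"
  obtains \<psi> where "\<psi> \<in> test_functions" "vderiv \<psi> = \<eta>"
proof -
  obtain R where R: "R \<ge> 0" "\<And>x. R < \<bar>x\<bar> \<Longrightarrow> \<eta> x = 0" 
    using \<eta> by (auto simp: test_functions_alt)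
  obtain K where K: "\<And>x. (K has_vector_derivative \<eta> x) (at x)"
    "\<And>x y. x \<le> y \<Longrightarrow> (LINT t:{x..y}|lborel. \<eta> t) = K y - K x"
    using continuous_antiderivative[OF test_function_continuous[OF \<eta>]] by blast
  \<comment> \<open>\<open>R + 1\<close> lies strictly beyond the support, as the strict inequality
    in \<open>vanish\<close> demands.\<close>
  define \<psi> where "\<psi> x = K x - K (R + 1)" for x
  have d: "(\<psi> has_vector_derivative \<eta> x) (at x)" for x
    unfolding \<psi>_def using has_vector_derivative_diff[OF K(1) has_vector_derivative_const] by simp
  have vanish: "(LINT t:{x..y}|lborel. \<eta> t) = 0" if "R < x \<or> y < - R" for x y
  proof -
    have "indicator {x..y} t *\<^sub>R \<eta> t = 0" for t
      using that R(2)[of t] R(1) by (cases "t \<in> {x..y}") auto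
    then show ?thesis unfolding set_lebesgue_integral_def by (simp only: integral_zero)
  qed
  have "(LINT t:{-(R+1)..R+1}|lborel. \<eta> t) = 0"
    using zero R by (subst integral_outside_support) (auto intro!: R(2))
  then have e: "K (R + 1) = K (- (R + 1))"
    using K(2)[of "-(R+1)" "R+1"] R(1) by simp
  have "\<psi> x = 0" if "R + 1 < \<bar>x\<bar>" for x
  proof (cases "x \<ge> 0")
    case True
    with that K(2)[of "R + 1" x] vanish[of "R + 1" x] show ?thesis by (simp add: \<psi>_def)
  next
    case False
    with that K(2)[of x "-(R + 1)"] vanish[of x "-(R + 1)"] e show ?thesis by (simp add: \<psi>_def)
  qed
  moreover have "k_diff n \<psi>" for n
  proof -
    have "k_diff (Suc n) \<psi>"
      by (rule k_diff_SucI[OF d]) (use \<eta> in \<open>auto simp: test_functions_alt\<close>)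
    then show ?thesis by (rule k_diff_SucD)
  qed
  ultimately have "\<psi> \<in> test_functions"
    using R(1) by (auto simp: test_functions_alt intro!: exI[of _ "R + 1"])
  with vderiv_eqI[OF d] that show ?thesis by blast
qed

text \<open>Subtracting a multiple of a fixed bump makes a test function integrate to zero, hence the derivative of a test function.\<close>

lemma du_Bois_Reymond:
  assumes u: "locally_integrable u"
    and zero: "\<And>\<psi>. \<psi> \<in> test_functions \<Longrightarrow> (LINT x|lborel. u x * vderiv \<psi> x) = 0"
  obtains C where "AE x in lborel. u x = C"
proof -
  have "(\<lambda>n. LINT x|lborel. 1 * cutoff 0 1 n x) \<longlonglongrightarrow> (LINT x:{0<..<1::real}|lborel. 1)"
    by (intro cutoff_integral_tendsto locally_integrable_continuous) auto
  then have "(\<lambda>n. LINT x|lborel. cutoff 0 1 n x) \<longlonglongrightarrow> 1"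
    by (simp add: set_lebesgue_integral_def)
  then have "\<exists>n. (LINT x|lborel. cutoff 0 1 n x) \<noteq> 0"
    by (rule contrapos_pp) (auto simp: LIMSEQ_const_iff)
  then obtain n where n: "(LINT x|lborel. cutoff 0 1 n x) \<noteq> 0" ..
  define \<rho> where "\<rho> = cutoff 0 1 n"
  have \<rho>: "\<rho> \<in> test_functions" "(LINT x|lborel. \<rho> x) \<noteq> 0"
    using n cutoff_test_function by (simp_all add: \<rho>_def)
  \<comment> \<open>The mean of \<open>u\<close> with weight \<open>\<rho>\<close>: the only
    candidate, since a constant \<open>u\<close> equals this mean.\<close>
  define C where "C = (LINT x|lborel. u x * \<rho> x) / (LINT x|lborel. \<rho> x)"
  have "AE x in lborel. u x - C = 0"
  proof (rule fundamental_lemma)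
    show "locally_integrable (\<lambda>x. u x - C)"
      by (intro locally_integrable_diff u locally_integrable_continuous) auto
    fix \<psi> assume \<psi>: "\<psi> \<in> test_functions"
    define \<gamma> where "\<gamma> = (LINT x|lborel. \<psi> x) / (LINT x|lborel. \<rho> x)"
    note int = test_function_integrable[OF \<psi>] test_function_integrable[OF \<rho>(1)]
      locally_integrable_times_test[OF u \<psi>] locally_integrable_times_test[OF u \<rho>(1)]
    have "(LINT x|lborel. \<psi> x - \<gamma> * \<rho> x) = 0"
      using int \<rho>(2) by (simp add: \<gamma>_def)
    then obtain \<chi>' where "\<chi>' \<in> test_functions" "vderiv \<chi>' = (\<lambda>x. \<psi> x - \<gamma> * \<rho> x)"
      using test_function_antiderivative[OF test_function_diff[OF \<psi> \<rho>(1)]] by metis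
    with zero[of \<chi>'] have "(LINT x|lborel. u x * \<psi> x - \<gamma> * (u x * \<rho> x)) = 0"
      by (simp add: algebra_simps)
    then have "(LINT x|lborel. u x * \<psi> x) = \<gamma> * (LINT x|lborel. u x * \<rho> x)"
      using int by simp
    also have "\<dots> = C * (LINT x|lborel. \<psi> x)"
      by (simp add: C_def \<gamma>_def)
    finally show "(LINT x|lborel. (u x - C) * \<psi> x) = 0"
      using int by (simp add: left_diff_distrib)
  qed
  then have "AE x in lborel. u x = C" by simp
  with that show ?thesis by blast
qed

section \<open>Primitives of locally integrable functions and integration by parts\<close>

lemma integral_vderiv_Ici:
  assumes \<psi>: "\<psi> \<in> test_functions"
  shows "(LINT x|lborel. indicator {t..} x *\<^sub>R vderiv \<psi> x) = - \<psi> t"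
proof -
  obtain R where R: "R \<ge> 0" "\<And>x. R < \<bar>x\<bar> \<Longrightarrow> \<psi> x = 0" 
    using \<psi> by (auto simp: test_functions_alt)
  obtain R' where R': "R' \<ge> 0" "\<And>x. R' < \<bar>x\<bar> \<Longrightarrow> vderiv \<psi> x = 0" 
    using test_function_vderiv[OF \<psi>] by (auto simp: test_functions_alt)
  define M where "M = R + R' + \<bar>t\<bar> + 1"
  have "(LINT x|lborel. indicator {t..} x *\<^sub>R vderiv \<psi> x) = (LINT x|lborel. indicator {t..M} x *\<^sub>R vderiv \<psi> x)"
    using R(1) R' by (intro Bochner_Integration.integral_cong) (auto simp: M_def indicator_def abs_if)
  also have "\<dots> = \<psi> M - \<psi> t"
  proof (rule integral_FTC_atLeastAtMost)
    show "t \<le> M" using R(1) R'(1) by (simp add: M_def abs_if)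
  qed (auto intro: has_vector_derivative_at_within[OF test_function_derivative[OF \<psi>]]
        test_function_continuous[OF test_function_vderiv[OF \<psi>]])
  also have "\<psi> M = 0"
    using R R'(1) by (auto simp: M_def)
  finally show ?thesis by simp
qed

lemma integral_vderiv:
  assumes \<psi>: "\<psi> \<in> test_functions"
  shows "(LINT x|lborel. vderiv \<psi> x) = 0"
proof -
  obtain R where R: "R \<ge> 0" "\<And>x. R < \<bar>x\<bar> \<Longrightarrow> \<psi> x = 0" 
    using \<psi> by (auto simp: test_functions_alt)
  obtain R' where R': "R' \<ge> 0" "\<And>x. R' < \<bar>x\<bar> \<Longrightarrow> vderiv \<psi> x = 0" 
    using test_function_vderiv[OF \<psi>] by (auto simp: test_functions_alt)
  have "(LINT x|lborel. vderiv \<psi> x) = (LINT x|lborel. indicator {-(R+R'+1)..} x *\<^sub>R vderiv \<psi> x)"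
    using R(1) R' by (intro Bochner_Integration.integral_cong) (auto simp: indicator_def)
  also have "\<dots> = 0"
    unfolding integral_vderiv_Ici[OF \<psi>] using R R'(1) by simp
  finally show ?thesis .
qed

text \<open>Fubini over the region t <= x: for fixed t the integral of \<open>vderiv \<psi>\<close>
  over x >= t is - \<psi>(t). Thus the formula holds without any pointwise derivative of the
  primitive.\<close>

lemma primitive_integral_by_parts:
  assumes v: "integrable lborel v" and \<psi>: "\<psi> \<in> test_functions"
  shows "(LINT x|lborel. (LINT t|lborel. indicator {..x} t *\<^sub>R v t) * vderiv \<psi> x) = - (LINT x|lborel. v x * \<psi> x)"
proof -
  note \<psi>' = test_function_vderiv[OF \<psi>]
  have [measurable]: "vderiv \<psi> \<in> borel_measurable borel" "v \<in> borel_measurable borel"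
    using \<psi>' v by measurable
  define F where "F t x = (if t \<le> x then v t * vderiv \<psi> x else 0)" for t x
  have [measurable]: "case_prod F \<in> borel_measurable (lborel \<Otimes>\<^sub>M lborel)"
    unfolding F_def by measurable
  have int: "integrable lborel (\<lambda>x. F t x)" for t
    by (rule Bochner_Integration.integrable_bound[where f="\<lambda>x. v t * vderiv \<psi> x"])
      (auto simp: F_def test_function_integrable[OF \<psi>'])
  have "integrable (lborel \<Otimes>\<^sub>M lborel) (case_prod F)"
  proof (rule lborel_pair.Fubini_integrable)
    show "integrable lborel (\<lambda>t. LINT x|lborel. norm (case (t, x) of (t, x) \<Rightarrow> F t x))"
    proof (rule Bochner_Integration.integrable_bound)
      show "integrable lborel (\<lambda>t. norm (v t) * (LINT x|lborel. norm (vderiv \<psi> x)))"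
        using v by simp
      have "(LINT x|lborel. norm (F t x)) \<le> (LINT x|lborel. norm (v t) * norm (vderiv \<psi> x))" for t
        by (intro integral_mono integrable_norm int integrable_mult_right test_function_integrable[OF \<psi>'])
          (auto simp: F_def norm_mult)
      then show "AE t in lborel. norm (LINT x|lborel. norm (case (t, x) of (t, x) \<Rightarrow> F t x)) \<le>
           norm (norm (v t) * (LINT x|lborel. norm (vderiv \<psi> x)))"
        by (simp add: order_trans[OF _ abs_ge_self])
    qed measurable
  qed (auto simp: int)
  from lborel_pair.Fubini_integral[OF this]
  have "(LINT x|lborel. LINT t|lborel. F t x) = (LINT t|lborel. LINT x|lborel. F t x)" .
  moreover have "(LINT x|lborel. F t x) = - (v t * \<psi> t)" for t
  proof -
    have "(LINT x|lborel. F t x) = (LINT x|lborel. v t * (indicator {t..} x *\<^sub>R vderiv \<psi> x))"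
      by (intro Bochner_Integration.integral_cong) (auto simp: F_def)
    also have "\<dots> = - (v t * \<psi> t)"
      by (subst integral_mult_right_zero) (simp add: integral_vderiv_Ici[OF \<psi>])
    finally show ?thesis .
  qed
  moreover have "(LINT t|lborel. F t x) = (LINT t|lborel. indicator {..x} t *\<^sub>R v t) * vderiv \<psi> x" for x
    by (subst integral_mult_left_zero[symmetric], intro Bochner_Integration.integral_cong) (auto simp: F_def)
  ultimately show ?thesis by simp
qed

lemma locally_integrable_primitive:
  assumes v: "locally_integrable v"
  obtains V where "continuous_on UNIV V" "\<And>x y. x \<le> y \<Longrightarrow> V y - V x = (LINT t:{x..y}|lborel. v t)"
proof -
  have io: "v integrable_on {a..b}" and io2: "(LINT t:{a..b}|lborel. v t) = integral {a..b} v" for a b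
    using set_borel_integral_eq_integral[of "{a..b}" v] v by (auto simp: locally_integrable_def)
  define V where "V x = (if 0 \<le> x then integral {0..x} v else - integral {x..0} v)" for x
  have V: "V y - V x = integral {x..y} v" if "x \<le> y" for x y
    using that Henstock_Kurzweil_Integration.integral_combine[of 0 x y v] Henstock_Kurzweil_Integration.integral_combine[of x 0 y v]
      Henstock_Kurzweil_Integration.integral_combine[of x y 0 v] io
    by (auto simp: V_def algebra_simps)
  have "isCont V x" for x
  proof -
    have "continuous_on {x-1..x+1} (\<lambda>y. V (x-1) + integral {x-1..y} v)"
      by (intro continuous_intros indefinite_integral_continuous_1 io)
    then have "continuous_on {x-1..x+1} V"
      by (rule continuous_on_eq) (simp add: V[symmetric])
    then show ?thesis
      by (rule continuous_on_interior) (auto simp: interior_atLeastAtMost_real)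
  qed
  then have "continuous_on UNIV V" by (simp add: continuous_on_eq_continuous_at)
  with V io2 that show ?thesis by auto
qed

text \<open>The counterpart of \<open>has_weak_derivative\<close> for Borel functions: the integrals
  are over \<open>lborel\<close>, where \<open>distr\<close> uses Lebesgue measure.\<close>

definition weak_deriv :: "(real \<Rightarrow> complex) \<Rightarrow> (real \<Rightarrow> complex) \<Rightarrow> bool" where
  "weak_deriv u v \<longleftrightarrow> (\<forall>\<psi>\<in>test_functions.
     (LINT x|lborel. v x * \<psi> x) = - (LINT x|lborel. u x * vderiv \<psi> x))"

text \<open>Outside [-N, N] both \<open>\<psi>\<close> and its derivative vanish, so
  \<open>v\<close> may be cut off there and becomes integrable. The base value V(-N) drops out
  because \<open>vderiv \<psi>\<close> has integral 0.\<close>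

lemma weak_deriv_primitive:
  assumes v: "locally_integrable v" and cont: "continuous_on UNIV V"
    and V: "\<And>x y. x \<le> y \<Longrightarrow> V y - V x = (LINT t:{x..y}|lborel. v t)"
  shows "weak_deriv V v"
  unfolding weak_deriv_def
proof
  fix \<psi> assume \<psi>: "\<psi> \<in> test_functions"
  note \<psi>' = test_function_vderiv[OF \<psi>]
  obtain R where R: "R \<ge> 0" "\<And>x. R < \<bar>x\<bar> \<Longrightarrow> \<psi> x = 0" 
    using \<psi> by (auto simp: test_functions_alt)
  obtain R' where R': "R' \<ge> 0" "\<And>x. R' < \<bar>x\<bar> \<Longrightarrow> vderiv \<psi> x = 0" 
    using \<psi>' by (auto simp: test_functions_alt)
  define N where "N = R + R'"
  define w where "w t = indicator {-N..N} t *\<^sub>R v t" for t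
  have w: "integrable lborel w"
    using v by (auto simp: locally_integrable_def set_integrable_def w_def[abs_def])
  have J: "V x * vderiv \<psi> x = V (- N) * vderiv \<psi> x + (LINT t|lborel. indicator {..x} t *\<^sub>R w t) * vderiv \<psi> x" for x
  proof (cases "x \<in> {-N..N}")
    case True
    have "(LINT t|lborel. indicator {..x} t *\<^sub>R w t) = (LINT t:{-N..x}|lborel. v t)"
      unfolding set_lebesgue_integral_def using True
      by (intro Bochner_Integration.integral_cong) (auto simp: w_def indicator_def)
    also have "\<dots> = V x - V (- N)" using True V by simp
    finally have "V x = V (- N) + (LINT t|lborel. indicator {..x} t *\<^sub>R w t)" by simp
    from arg_cong[OF this, of "\<lambda>z. z * vderiv \<psi> x"] show ?thesis by (simp only: distrib_right)
  next
    case False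
    then have "vderiv \<psi> x = 0" using R(1) R' by (auto simp: N_def abs_if)
    then show ?thesis by simp
  qed
  have "integrable lborel (\<lambda>x. V x * vderiv \<psi> x - V (- N) * vderiv \<psi> x)"
    by (intro Bochner_Integration.integrable_diff locally_integrable_times_test[OF locally_integrable_continuous[OF cont] \<psi>']
        integrable_mult_right test_function_integrable[OF \<psi>'])
  then have "integrable lborel (\<lambda>x. (LINT t|lborel. indicator {..x} t *\<^sub>R w t) * vderiv \<psi> x)"
    unfolding J by simp
  then have "(LINT x|lborel. V x * vderiv \<psi> x) = V (- N) * (LINT x|lborel. vderiv \<psi> x)
      + (LINT x|lborel. (LINT t|lborel. indicator {..x} t *\<^sub>R w t) * vderiv \<psi> x)"
    unfolding J using test_function_integrable[OF \<psi>'] by simp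
  also have "\<dots> = - (LINT x|lborel. w x * \<psi> x)"
    by (simp add: integral_vderiv[OF \<psi>] primitive_integral_by_parts[OF w \<psi>])
  also have "(LINT x|lborel. w x * \<psi> x) = (LINT x|lborel. v x * \<psi> x)"
    using R R'(1) by (intro Bochner_Integration.integral_cong) (auto simp: w_def N_def indicator_def abs_if)
  finally show "(LINT x|lborel. v x * \<psi> x) = - (LINT x|lborel. V x * vderiv \<psi> x)" by simp
qed

lemma primitive_has_vector_derivative:
  fixes v :: "real \<Rightarrow> complex"
  assumes v: "continuous_on UNIV v"
    and U: "\<And>x y. x \<le> y \<Longrightarrow> U y - U x = (LINT t:{x..y}|lborel. v t)"
  shows "(U has_vector_derivative v x) (at x)"
proof -
  obtain F where F: "\<And>x. (F has_vector_derivative v x) (at x)"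
    "\<And>x y. x \<le> y \<Longrightarrow> (LINT t:{x..y}|lborel. v t) = F y - F x"
    using continuous_antiderivative[OF v] by blast
  have "U y = F y + (U 0 - F 0)" for y
    using U[of 0 y] U[of y 0] F(2)[of 0 y] F(2)[of y 0] by (cases "0 \<le> y") (auto simp: algebra_simps)
  then have "U = (\<lambda>y. F y + (U 0 - F 0))" by (rule ext)
  moreover have "((\<lambda>y. F y + (U 0 - F 0)) has_vector_derivative v x + 0) (at x)"
    by (intro has_vector_derivative_add F has_vector_derivative_const)
  ultimately show ?thesis by (metis add.right_neutral)
qed

lemma weak_deriv_classical:
  assumes f: "\<And>x. (f has_vector_derivative f' x) (at x)" and f': "continuous_on UNIV f'"
  shows "weak_deriv f f'"
proof (rule weak_deriv_primitive)
  show "continuous_on UNIV f"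
    using has_vector_derivative_continuous[OF f] by (simp add: continuous_on_eq_continuous_at)
  show "f y - f x = (LINT t:{x..y}|lborel. f' t)" if "x \<le> y" for x y
    unfolding set_lebesgue_integral_def using that
    by (intro integral_FTC_atLeastAtMost[symmetric]) (auto intro: has_vector_derivative_at_within[OF f] continuous_on_subset[OF f'])
qed (rule locally_integrable_continuous[OF f'])

text \<open>\<open>u\<close> and a continuous primitive \<open>V\<close> of \<open>v\<close> have
  the same weak derivative, so their difference is almost everywhere constant; adding this constant
  to \<open>V\<close> gives the continuous representative.\<close>

lemma weak_deriv_AE_primitive:
  assumes u: "locally_integrable u" and v: "locally_integrable v" and d: "weak_deriv u v"
  obtains U where "continuous_on UNIV U" "AE x in lborel. u x = U x"
    "\<And>x y. x \<le> y \<Longrightarrow> U y - U x = (LINT t:{x..y}|lborel. v t)"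
proof -
  obtain V where V: "continuous_on UNIV V" "\<And>x y. x \<le> y \<Longrightarrow> V y - V x = (LINT t:{x..y}|lborel. v t)"
    using locally_integrable_primitive[OF v] by blast
  have dV: "weak_deriv V v" by (rule weak_deriv_primitive[OF v V])
  have lV: "locally_integrable V" by (rule locally_integrable_continuous[OF V(1)])
  obtain C where C: "AE x in lborel. u x - V x = C"
  proof (rule du_Bois_Reymond[OF locally_integrable_diff[OF u lV]])
    fix \<psi> assume \<psi>: "\<psi> \<in> test_functions"
    note int = locally_integrable_times_test[OF u test_function_vderiv[OF \<psi>]]
      locally_integrable_times_test[OF lV test_function_vderiv[OF \<psi>]]
    have "(LINT x|lborel. u x * vderiv \<psi> x) = (LINT x|lborel. V x * vderiv \<psi> x)"
      using d dV \<psi> by (auto simp: weak_deriv_def)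
    then show "(LINT x|lborel. (u x - V x) * vderiv \<psi> x) = 0"
      using int by (simp add: left_diff_distrib)
  qed
  show ?thesis
  proof (rule that[of "\<lambda>x. V x + C"])
    show "continuous_on UNIV (\<lambda>x. V x + C)" by (intro continuous_intros V)
    show "AE x in lborel. u x = V x + C" using C by eventually_elim (simp add: algebra_simps)
  qed (use V in auto)
qed

section \<open>Regularity of weak solutions\<close>

lemma AE_lebesgue_iff: "(AE x in lebesgue. P x) \<longleftrightarrow> (AE x in lborel. P x)"
  by (rule AE_completion_iff)

lemma borel_imp_lebesgue_measurable: "f \<in> borel_measurable borel \<Longrightarrow> f \<in> borel_measurable lebesgue"
  by (simp add: measurable_completion)

lemma distr_eq_lborel:
  assumes [measurable]: "f \<in> borel_measurable lebesgue" "f' \<in> borel_measurable borel"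
    and ae: "AE x in lborel. f x = f' x" and \<psi>: "\<psi> \<in> test_functions"
  shows "distr f \<psi> = (LINT x|lborel. f' x * \<psi> x)"
proof -
  have m: "\<psi> \<in> borel_measurable borel" using \<psi> by measurable
  note [measurable] = m borel_imp_lebesgue_measurable[OF m] borel_imp_lebesgue_measurable[OF assms(2)]
  have "distr f \<psi> = (LINT x|lebesgue. f' x * \<psi> x)"
    unfolding distr_def using ae
    by (intro integral_cong_AE) (auto simp: AE_lebesgue_iff)
  also have "\<dots> = (LINT x|lborel. f' x * \<psi> x)"
    by (rule integral_completion) measurable
  finally show ?thesis .
qed

lemma L2_borel_representative:
  assumes "f \<in> L2"
  obtains f' where "f' \<in> borel_measurable borel" "AE x in lborel. f x = f' x"
    "integrable lborel (\<lambda>x. (norm (f' x))\<^sup>2)"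
proof -
  have f [measurable]: "f \<in> borel_measurable lebesgue" and int: "integrable lebesgue (\<lambda>x. (norm (f x))\<^sup>2)"
    using assms by (auto simp: L2_def)
  obtain r where r: "r \<in> borel_measurable lborel" "AE x in lborel. Re (f x) = r x"
    using completion_ex_borel_measurable_real[of "\<lambda>x. Re (f x)" lborel] by auto
  obtain i where i: "i \<in> borel_measurable lborel" "AE x in lborel. Im (f x) = i x"
    using completion_ex_borel_measurable_real[of "\<lambda>x. Im (f x)" lborel] by auto
  define f' where "f' x = Complex (r x) (i x)" for x
  have m [measurable]: "f' \<in> borel_measurable borel"
    using r i unfolding f'_def by (simp add: Complex_eq)
  note [measurable] = borel_imp_lebesgue_measurable[OF m]
  have ae: "AE x in lborel. f x = f' x"
    using r(2) i(2) by eventually_elim (simp add: f'_def complex_eq_iff)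
  have "integrable lebesgue (\<lambda>x. (norm (f' x))\<^sup>2)"
    using int by (rule Bochner_Integration.integrable_cong_AE_imp) (use ae in \<open>auto simp: AE_lebesgue_iff\<close>)
  then have "integrable lborel (\<lambda>x. (norm (f' x))\<^sup>2)"
    by (subst (asm) integrable_completion) auto
  with m ae that show ?thesis by blast
qed

lemma L2_I:
  assumes "continuous_on UNIV f" "integrable lborel (\<lambda>x. (norm (f x))\<^sup>2)"
  shows "f \<in> L2"
proof -
  have [measurable]: "f \<in> borel_measurable borel"
    using assms(1) by (rule borel_measurable_continuous_onI)
  have "integrable lebesgue (\<lambda>x. (norm (f x))\<^sup>2)"
    using assms(2) by (subst integrable_completion) auto
  then show ?thesis by (simp add: L2_def borel_imp_lebesgue_measurable)
qed

text \<open>On a bounded interval |u| is dominated by 1 + |u|^2; the elementary inequality n <= n^2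
  + 1/4 comes from (n - 1/2)^2 >= 0.\<close>

lemma locally_integrable_L2:
  assumes [measurable]: "u \<in> borel_measurable borel" and int: "integrable lborel (\<lambda>x. (norm (u x))\<^sup>2)"
  shows "locally_integrable u"
  unfolding locally_integrable_def
proof (intro conjI allI)
  fix a b :: real
  have "integrable lborel (\<lambda>x. indicator {a..b} x *\<^sub>R (1::real) + (norm (u x))\<^sup>2)"
    using int by (intro Bochner_Integration.integrable_add integrable_scaleR_left integrable_real_indicator) (auto simp: emeasure_lborel_Icc_eq)
  then show "set_integrable lborel {a..b} u"
    unfolding set_integrable_def
  proof (rule Bochner_Integration.integrable_bound)
    have "n \<le> 1 + n\<^sup>2" for n :: real
      by (rule order_trans[of _ "1/4 + n\<^sup>2"]) (use zero_le_power2[of "n - 1/2"] in \<open>auto simp: power2_eq_square algebra_simps\<close>)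
    then show "AE x in lborel. norm (indicator {a..b} x *\<^sub>R u x) \<le> norm (indicator {a..b} x *\<^sub>R (1::real) + (norm (u x))\<^sup>2)"
      by (auto simp: indicator_def)
  qed measurable
qed fact

lemma locally_integrable_add:
  "locally_integrable u \<Longrightarrow> locally_integrable v \<Longrightarrow> locally_integrable (\<lambda>x. u x + v x)"
  unfolding locally_integrable_def by (auto intro: set_integral_add)

lemma locally_integrable_cnj:
  assumes "locally_integrable u"
  shows "locally_integrable (\<lambda>x. cnj (u x))"
proof -
  have [measurable]: "u \<in> borel_measurable borel" using assms by measurable
  have "(\<lambda>x. cnj (u x)) \<in> borel_measurable borel"
    by (rule measurable_compose[OF _ borel_measurable_continuous_onI[OF continuous_on_cnj[OF continuous_on_id]]]) measurable
  moreover have "set_integrable lborel {a..b} (\<lambda>x. cnj (u x))" for a b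
  proof -
    have "integrable lborel (\<lambda>x. cnj (indicator {a..b} x *\<^sub>R u x))"
      using assms by (intro integrable_cnj) (auto simp: locally_integrable_def set_integrable_def)
    then show ?thesis by (simp add: set_integrable_def)
  qed
  ultimately show ?thesis by (simp add: locally_integrable_def)
qed

lemma locally_integrable_mult_continuous:
  assumes k: "continuous_on UNIV k" and u: "locally_integrable u"
  shows "locally_integrable (\<lambda>x. k x * u x)"
proof -
  have [measurable]: "u \<in> borel_measurable borel" "k \<in> borel_measurable borel"
    using u borel_measurable_continuous_onI[OF k] by auto
  have "set_integrable lborel {a..b} (\<lambda>x. k x * u x)" for a b
  proof -
    have "bounded (k ` {a..b})"
      by (intro compact_imp_bounded compact_continuous_image continuous_on_subset[OF k]) auto
    then obtain B where B: "B > 0" "\<And>x. x \<in> {a..b} \<Longrightarrow> norm (k x) \<le> B"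
      by (metis bounded_pos imageI)
    have "integrable lborel (\<lambda>x. B *\<^sub>R (indicator {a..b} x *\<^sub>R u x))"
      using u by (intro integrable_scaleR_right) (auto simp: locally_integrable_def set_integrable_def)
    then show ?thesis
      unfolding set_integrable_def
    proof (rule Bochner_Integration.integrable_bound)
      have "norm (indicator {a..b} x *\<^sub>R (k x * u x)) \<le> norm (B *\<^sub>R (indicator {a..b} x *\<^sub>R u x))" for x
        using mult_right_mono[OF B(2)[of x] norm_ge_zero[of "u x"]] B(1) by (auto simp: indicator_def norm_mult)
      then show "AE x in lborel. norm (indicator {a..b} x *\<^sub>R (k x * u x)) \<le> norm (B *\<^sub>R (indicator {a..b} x *\<^sub>R u x))"
        by simp
    qed measurable
  qed
  then show ?thesis by (simp add: locally_integrable_def)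
qed

section \<open>Weak and classical solutions of the profile equation\<close>

definition dnls_rhs :: "real \<Rightarrow> complex \<Rightarrow> complex \<Rightarrow> complex" where
  "dnls_rhs c z w = - \<i> * of_real c * w + 1 / 2 * \<i> * of_real ((cmod z)\<^sup>2) * w - 1 / 2 * \<i> * z\<^sup>2 * cnj w"

text \<open>The value of $\varphi''$ that the equation prescribes when $\varphi = z$ and $\varphi' = w$.\<close>

definition dnls_second :: "real \<Rightarrow> real \<Rightarrow> complex \<Rightarrow> complex \<Rightarrow> complex" where
  "dnls_second \<omega> c z w = of_real \<omega> * z - 3 / 16 * of_real (cmod z ^ 4) * z - dnls_rhs c z w"

lemma locally_integrable_dnls:
  assumes u: "continuous_on UNIV u" and g: "locally_integrable g"
  shows "locally_integrable (\<lambda>x. of_real \<omega> * u x)"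
    and "locally_integrable (\<lambda>x. 3 / 16 * of_real (cmod (u x) ^ 4) * u x)"
    and "locally_integrable (\<lambda>x. dnls_rhs c (u x) (g x))"
proof -
  show "locally_integrable (\<lambda>x. of_real \<omega> * u x)" "locally_integrable (\<lambda>x. 3 / 16 * of_real (cmod (u x) ^ 4) * u x)"
    by (intro locally_integrable_continuous continuous_intros u)+
  have "locally_integrable (\<lambda>x. (- \<i> * of_real c + 1 / 2 * \<i> * of_real ((cmod (u x))\<^sup>2)) * g x + (- (1 / 2 * \<i> * (u x)\<^sup>2)) * cnj (g x))"
    by (intro locally_integrable_add locally_integrable_mult_continuous locally_integrable_cnj g continuous_intros u)
  then show "locally_integrable (\<lambda>x. dnls_rhs c (u x) (g x))"
    by (simp add: dnls_rhs_def algebra_simps)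
qed

lemma integral_dnls_second:
  assumes u: "continuous_on UNIV u" and g: "locally_integrable g" and \<psi>: "\<psi> \<in> test_functions"
  shows "(LINT x|lborel. dnls_second \<omega> c (u x) (g x) * \<psi> x) =
    (LINT x|lborel. of_real \<omega> * u x * \<psi> x) - (LINT x|lborel. 3 / 16 * of_real (cmod (u x) ^ 4) * u x * \<psi> x)
     - (LINT x|lborel. dnls_rhs c (u x) (g x) * \<psi> x)"
proof -
  note int = locally_integrable_dnls[OF u g, THEN locally_integrable_times_test, OF \<psi>]
  show ?thesis
    unfolding dnls_second_def left_diff_distrib
    by (subst Bochner_Integration.integral_diff, (intro Bochner_Integration.integrable_diff int)+)+ simp
qed

definition classical_dnls :: "real \<Rightarrow> real \<Rightarrow> (real \<Rightarrow> complex) \<Rightarrow> (real \<Rightarrow> complex) \<Rightarrow> bool" where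
  "classical_dnls \<omega> c f g \<longleftrightarrow>
     (\<forall>x. (f has_vector_derivative g x) (at x)) \<and>
     (\<forall>x. (g has_vector_derivative dnls_second \<omega> c (f x) (g x)) (at x)) \<and>
     integrable lborel (\<lambda>x. (norm (f x))\<^sup>2) \<and> integrable lborel (\<lambda>x. (norm (g x))\<^sup>2)"

lemma dnls_second_continuous:
  assumes "continuous_on UNIV u" "continuous_on UNIV g"
  shows "continuous_on UNIV (\<lambda>x. dnls_second \<omega> c (u x) (g x))"
  unfolding dnls_second_def dnls_rhs_def by (intro continuous_intros assms)

text \<open>Moves the second-derivative term across the tested equation. Stated for plain complex
  numbers, it lets the long integrals be matched as atoms.\<close>

lemma diff_swap: "a - p - b = r \<Longrightarrow> a - b - r = p" and diff_swap': "a - b - r = p \<Longrightarrow> a - p - b = r"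
  for a b p r :: complex
  by (auto simp: algebra_simps)

text \<open>A bootstrap in two rounds. Since the weak derivative \<open>g\<close> is locally
  integrable, \<phi> has a continuous representative \<open>U\<close>. Then the nonlinear terms are
  continuous coefficients times \<open>g\<close> or its conjugate, hence locally integrable, and so
  \<open>g\<close> has a continuous representative \<open>G\<close>. Replacing \<open>g\<close> by
  \<open>G\<close> under both integrals makes the integrands continuous, which gives classical
  derivatives of \<open>U\<close> and \<open>G\<close>.\<close>

lemma dnls_profile_regularity:
  assumes sol: "dnls_profile_solution \<omega> c \<phi>"
  obtains f g where "classical_dnls \<omega> c f g" "AE x in lebesgue. \<phi> x = f x"
proof -
  obtain d where \<phi>: "\<phi> \<in> L2" and d: "d \<in> L2" and wd: "has_weak_derivative \<phi> d"
    and eq: "\<And>\<psi>. \<psi> \<in> test_functions \<Longrightarrow>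
          distr (\<lambda>x. of_real \<omega> * \<phi> x) \<psi> - distr \<phi> (vderiv (vderiv \<psi>))
          - distr (\<lambda>x. 3 / 16 * of_real (cmod (\<phi> x) ^ 4) * \<phi> x) \<psi>
          = distr (\<lambda>x. dnls_rhs c (\<phi> x) (d x)) \<psi>"
    using sol by (auto simp: dnls_profile_solution_def H1_def dnls_rhs_def)
  have m\<phi> [measurable]: "\<phi> \<in> borel_measurable lebesgue" and md [measurable]: "d \<in> borel_measurable lebesgue"
    using \<phi> d by (auto simp: L2_def)
  obtain u where u: "u \<in> borel_measurable borel" "AE x in lborel. \<phi> x = u x" "integrable lborel (\<lambda>x. (norm (u x))\<^sup>2)"
    using L2_borel_representative[OF \<phi>] by blast
  obtain g where g: "g \<in> borel_measurable borel" "AE x in lborel. d x = g x" "integrable lborel (\<lambda>x. (norm (g x))\<^sup>2)"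
    using L2_borel_representative[OF d] by blast
  note lu = locally_integrable_L2[OF u(1,3)] and lg = locally_integrable_L2[OF g(1,3)]
  have wug: "(LINT x|lborel. g x * \<psi> x) = - (LINT x|lborel. u x * vderiv \<psi> x)" if \<psi>: "\<psi> \<in> test_functions" for \<psi>
    using wd \<psi> test_function_vderiv[OF \<psi>]
    by (simp add: has_weak_derivative_def distr_eq_lborel[OF md g(1,2)] distr_eq_lborel[OF m\<phi> u(1,2)])
  then have "weak_deriv u g" by (simp add: weak_deriv_def)
  then obtain U where U: "continuous_on UNIV U" "AE x in lborel. u x = U x"
    "\<And>x y. x \<le> y \<Longrightarrow> U y - U x = (LINT t:{x..y}|lborel. g t)"
    using weak_deriv_AE_primitive[OF lu lg] by blast
  have mU [measurable]: "U \<in> borel_measurable borel" "g \<in> borel_measurable borel"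
    using borel_measurable_continuous_onI[OF U(1)] g(1) by auto
  have \<phi>U: "AE x in lborel. \<phi> x = U x"
    using u(2) U(2) by eventually_elim simp
  note l = locally_integrable_dnls[OF U(1) lg]
  have lN: "locally_integrable (\<lambda>x. dnls_second \<omega> c (U x) (g x))"
    unfolding dnls_second_def by (intro locally_integrable_diff l)
  have "weak_deriv g (\<lambda>x. dnls_second \<omega> c (U x) (g x))"
    unfolding weak_deriv_def
  proof
    fix \<psi> assume \<psi>: "\<psi> \<in> test_functions"
    note \<psi>' = test_function_vderiv[OF \<psi>]
    note \<psi>'' = test_function_vderiv[OF \<psi>']
    have "distr (\<lambda>x. of_real \<omega> * \<phi> x) \<psi> = (LINT x|lborel. of_real \<omega> * U x * \<psi> x)"
      by (rule distr_eq_lborel[OF _ _ _ \<psi>]) (measurable, use \<phi>U in eventually_elim, simp)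
    moreover have "distr (\<lambda>x. 3 / 16 * of_real (cmod (\<phi> x) ^ 4) * \<phi> x) \<psi> = (LINT x|lborel. 3 / 16 * of_real (cmod (U x) ^ 4) * U x * \<psi> x)"
      by (rule distr_eq_lborel[OF _ _ _ \<psi>]) (measurable, use \<phi>U in eventually_elim, simp)
    moreover have "distr (\<lambda>x. dnls_rhs c (\<phi> x) (d x)) \<psi> = (LINT x|lborel. dnls_rhs c (U x) (g x) * \<psi> x)"
    proof (rule distr_eq_lborel[OF _ _ _ \<psi>])
      have [measurable]: "cnj \<in> borel_measurable borel"
        by (rule borel_measurable_continuous_onI) (intro continuous_intros)
      show "(\<lambda>x. dnls_rhs c (\<phi> x) (d x)) \<in> borel_measurable lebesgue" 
        "(\<lambda>x. dnls_rhs c (U x) (g x)) \<in> borel_measurable borel"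
        unfolding dnls_rhs_def by measurable
      show "AE x in lborel. dnls_rhs c (\<phi> x) (d x) = dnls_rhs c (U x) (g x)"
        using \<phi>U g(2) by eventually_elim simp
    qed
    \<comment> \<open>The weak derivative tested with \<psi>', itself a test function, turns the
      pairing with \<psi>'' into one with \<psi>'.\<close>
    moreover have "distr \<phi> (vderiv (vderiv \<psi>)) = - (LINT x|lborel. g x * vderiv \<psi> x)"
      using wug[OF \<psi>'] by (simp add: distr_eq_lborel[OF m\<phi> u(1,2) \<psi>''])
    ultimately show "(LINT x|lborel. dnls_second \<omega> c (U x) (g x) * \<psi> x) = - (LINT x|lborel. g x * vderiv \<psi> x)"
      unfolding integral_dnls_second[OF U(1) lg \<psi>] using eq[OF \<psi>] by - (rule diff_swap, simp only:)
  qed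
  then obtain G where G: "continuous_on UNIV G" "AE x in lborel. g x = G x"
    "\<And>x y. x \<le> y \<Longrightarrow> G y - G x = (LINT t:{x..y}|lborel. dnls_second \<omega> c (U t) (g t))"
    using weak_deriv_AE_primitive[OF lg lN] by blast
  have mG [measurable]: "G \<in> borel_measurable borel"
    using borel_measurable_continuous_onI[OF G(1)] by auto
  note cN = dnls_second_continuous[OF U(1) G(1), of \<omega> c]
  have mN: "(\<lambda>x. dnls_second \<omega> c (U x) (G x)) \<in> borel_measurable borel"
    "(\<lambda>x. dnls_second \<omega> c (U x) (g x)) \<in> borel_measurable borel"
    using borel_measurable_continuous_onI[OF cN] lN by (auto simp: locally_integrable_def)
  have "U y - U x = (LINT t:{x..y}|lborel. G t)" if "x \<le> y" for x y
    unfolding U(3)[OF that] set_lebesgue_integral_def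
    by (rule integral_cong_AE) (measurable, use G(2) in eventually_elim, simp)
  then have dU: "(U has_vector_derivative G x) (at x)" for x
    by (rule primitive_has_vector_derivative[OF G(1)])
  have "G y - G x = (LINT t:{x..y}|lborel. dnls_second \<omega> c (U t) (G t))" if "x \<le> y" for x y
    unfolding G(3)[OF that] set_lebesgue_integral_def
  proof (rule integral_cong_AE)
    show "AE t in lborel. indicator {x..y} t *\<^sub>R dnls_second \<omega> c (U t) (g t) = indicator {x..y} t *\<^sub>R dnls_second \<omega> c (U t) (G t)"
      using G(2) by eventually_elim simp
  qed (use mN in measurable)
  then have dG: "(G has_vector_derivative dnls_second \<omega> c (U x) (G x)) (at x)" for x
    by (rule primitive_has_vector_derivative[OF cN])
  have "integrable lborel (\<lambda>x. (norm (U x))\<^sup>2)"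
    using u(3) by (rule Bochner_Integration.integrable_cong_AE_imp) (measurable, use U(2) in eventually_elim, simp)
  moreover have "integrable lborel (\<lambda>x. (norm (G x))\<^sup>2)"
    using g(3) by (rule Bochner_Integration.integrable_cong_AE_imp) (measurable, use G(2) in eventually_elim, simp)
  ultimately have "classical_dnls \<omega> c U G"
    using dU dG by (simp add: classical_dnls_def)
  with \<phi>U that show ?thesis by (simp add: AE_lebesgue_iff)
qed

lemma classical_dnls_continuous:
  assumes "classical_dnls \<omega> c f g"
  shows "continuous_on UNIV f" "continuous_on UNIV g"
  using assms unfolding classical_dnls_def continuous_on_eq_continuous_at[OF open_UNIV]
  by (blast intro: has_vector_derivative_continuous)+

text \<open>The direction that shows the soliton to be a weak solution: two integrations by parts,
  through \<open>g\<close>, put both derivatives on the test function.\<close>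

lemma classical_dnls_profile_solution:
  assumes sol: "classical_dnls \<omega> c f g"
  shows "dnls_profile_solution \<omega> c f"
proof -
  note cont = classical_dnls_continuous[OF sol]
  have [measurable]: "f \<in> borel_measurable borel" "g \<in> borel_measurable borel"
    using cont by (auto intro: borel_measurable_continuous_onI)
  have L2: "f \<in> L2" "g \<in> L2"
    using sol cont by (auto intro: L2_I simp: classical_dnls_def)
  note lg = locally_integrable_continuous[OF cont(2)]
  have fg: "weak_deriv f g"
    by (rule weak_deriv_classical) (use sol cont in \<open>auto simp: classical_dnls_def\<close>)
  have gN: "weak_deriv g (\<lambda>x. dnls_second \<omega> c (f x) (g x))"
    by (rule weak_deriv_classical[OF _ dnls_second_continuous[OF cont]]) (use sol in \<open>auto simp: classical_dnls_def\<close>)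
  have ds: "distr h \<psi> = (LINT x|lborel. h x * \<psi> x)" if "continuous_on UNIV h" "\<psi> \<in> test_functions" for h \<psi>
    by (rule distr_eq_lborel) (use borel_measurable_continuous_onI[OF that(1)] that(2) in \<open>auto intro: borel_imp_lebesgue_measurable\<close>)
  have wd: "has_weak_derivative f g"
    using fg by (simp add: has_weak_derivative_def weak_deriv_def ds cont test_function_vderiv)
  have "distr (\<lambda>x. of_real \<omega> * f x) \<psi> - distr f (vderiv (vderiv \<psi>))
          - distr (\<lambda>x. 3 / 16 * of_real (cmod (f x) ^ 4) * f x) \<psi>
          = distr (\<lambda>x. dnls_rhs c (f x) (g x)) \<psi>" if \<psi>: "\<psi> \<in> test_functions" for \<psi>
  proof -
    note \<psi>' = test_function_vderiv[OF \<psi>]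
    note \<psi>'' = test_function_vderiv[OF \<psi>']
    have "distr (\<lambda>x. of_real \<omega> * f x) \<psi> = (LINT x|lborel. of_real \<omega> * f x * \<psi> x)"
       "distr (\<lambda>x. 3 / 16 * of_real (cmod (f x) ^ 4) * f x) \<psi> = (LINT x|lborel. 3 / 16 * of_real (cmod (f x) ^ 4) * f x * \<psi> x)"
       "distr (\<lambda>x. dnls_rhs c (f x) (g x)) \<psi> = (LINT x|lborel. dnls_rhs c (f x) (g x) * \<psi> x)"
       "distr f (vderiv (vderiv \<psi>)) = (LINT x|lborel. f x * vderiv (vderiv \<psi>) x)"
      unfolding dnls_rhs_def by (intro ds \<psi> \<psi>'' continuous_intros cont)+
    moreover have "(LINT x|lborel. dnls_second \<omega> c (f x) (g x) * \<psi> x) = (LINT x|lborel. f x * vderiv (vderiv \<psi>) x)"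
      using fg gN \<psi> \<psi>' by (simp add: weak_deriv_def)
    ultimately show ?thesis
      unfolding integral_dnls_second[OF cont(1) lg \<psi>] by - (rule diff_swap', simp only:)
  qed
  with L2 wd show ?thesis
    unfolding dnls_profile_solution_def H1_def dnls_rhs_def by blast
qed

section \<open>The gauged equation and its conserved quantities\<close>

text \<open>The term c/2 s appears because Im(cnj \<phi> \<phi>') equals Im(cnj h h') + c/2 |h|^2;
  the shift - c^2/4 is what remains after the gauge cancels the first-order term.\<close>

definition dnls_potential :: "real \<Rightarrow> real \<Rightarrow> real \<Rightarrow> real" where
  "dnls_potential \<omega> c s = (\<omega> - c\<^sup>2 / 4) + c / 2 * s - 3 / 16 * s\<^sup>2"

text \<open>The system satisfied by $h = e^{-icx/2}\varphi$ and $k = h'$.\<close>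

definition gauged_dnls :: "real \<Rightarrow> real \<Rightarrow> (real \<Rightarrow> complex) \<Rightarrow> (real \<Rightarrow> complex) \<Rightarrow> bool" where
  "gauged_dnls \<omega> c h k \<longleftrightarrow>
     (\<forall>x. (h has_vector_derivative k x) (at x)) \<and>
     (\<forall>x. (k has_vector_derivative
        of_real (dnls_potential \<omega> c ((cmod (h x))\<^sup>2) + Im (cnj (h x) * k x)) * h x) (at x)) \<and>
     integrable lborel (\<lambda>x. (cmod (h x))\<^sup>2) \<and> integrable lborel (\<lambda>x. (cmod (k x))\<^sup>2)"

text \<open>The equation commutes with multiplication by a unimodular constant, so the factor
  \<open>cis t\<close> can be pulled out. The rest is a polynomial identity in real and imaginary
  parts, resting on i/2 (|z|^2 w - z^2 cnj w) = - Im(cnj z w) z.\<close>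

lemma dnls_second_gauge:
  "dnls_second \<omega> c (cis t * z) (cis t * (w + \<i> * of_real (c / 2) * z)) =
     cis t * (of_real (dnls_potential \<omega> c ((cmod z)\<^sup>2) + Im (cnj z * w)) * z + \<i> * of_real c * w - of_real (c\<^sup>2 / 4) * z)"
proof -
  have e1: "cis t * cnj (cis t) = 1"
    by (simp add: complex_eq_iff flip: power2_eq_square)
  then have cc: "cis t * (cis t * (cnj (cis t) * v)) = cis t * v" for v
    by (metis mult.assoc mult_1)
  have "dnls_second \<omega> c (cis t * z) (cis t * v) = cis t * dnls_second \<omega> c z v" for v
    unfolding dnls_second_def dnls_rhs_def
    by (simp add: norm_mult power2_eq_square algebra_simps cc e1)
  moreover have "dnls_second \<omega> c z (w + \<i> * of_real (c / 2) * z) =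
     of_real (dnls_potential \<omega> c ((cmod z)\<^sup>2) + Im (cnj z * w)) * z + \<i> * of_real c * w - of_real (c\<^sup>2 / 4) * z"
  proof -
    have m4: "cmod z ^ 4 = ((Re z)\<^sup>2 + (Im z)\<^sup>2)\<^sup>2"
      unfolding cmod_power2[symmetric] by (simp flip: power_mult)
    show ?thesis
      unfolding dnls_second_def dnls_rhs_def dnls_potential_def m4 cmod_power2
      by (simp add: complex_eq_iff power2_eq_square) (simp add: field_simps)
  qed
  ultimately show ?thesis by simp
qed

lemma cis_vector_derivative:
  "((\<lambda>x. cis (b * x)) has_vector_derivative \<i> * of_real b * cis (b * x)) (at x)"
  unfolding cis_conv_exp
  by (auto intro!: derivative_eq_intros exp_scaleR_has_vector_derivative_right simp: has_vector_derivative_complex_iff Re_exp Im_exp)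

lemma square_integrable_add:
  fixes f g :: "real \<Rightarrow> complex"
  assumes [measurable]: "f \<in> borel_measurable borel" "g \<in> borel_measurable borel"
    and int: "integrable lborel (\<lambda>x. (cmod (f x))\<^sup>2)" "integrable lborel (\<lambda>x. (cmod (g x))\<^sup>2)"
  shows "integrable lborel (\<lambda>x. (cmod (f x + b * g x))\<^sup>2)"
proof (rule Bochner_Integration.integrable_bound)
  show "integrable lborel (\<lambda>x. 2 * (cmod (f x))\<^sup>2 + 2 * (cmod b)\<^sup>2 * (cmod (g x))\<^sup>2)"
    using int by simp
  have "(cmod (f x + b * g x))\<^sup>2 \<le> 2 * (cmod (f x))\<^sup>2 + 2 * (cmod b)\<^sup>2 * (cmod (g x))\<^sup>2" for x
  proof -
    have "(cmod (f x + b * g x))\<^sup>2 \<le> (cmod (f x) + cmod b * cmod (g x))\<^sup>2"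
      by (intro power_mono order_trans[OF norm_triangle_ineq]) (auto simp: norm_mult)
    also have "\<dots> \<le> 2 * (cmod (f x))\<^sup>2 + 2 * (cmod b)\<^sup>2 * (cmod (g x))\<^sup>2"
      using zero_le_power2[of "cmod (f x) - cmod b * cmod (g x)"] by (simp add: power2_eq_square algebra_simps)
    finally show ?thesis .
  qed
  then show "AE x in lborel. norm ((cmod (f x + b * g x))\<^sup>2) \<le> norm (2 * (cmod (f x))\<^sup>2 + 2 * (cmod b)\<^sup>2 * (cmod (g x))\<^sup>2)"
    by (simp add: order_trans[OF _ abs_ge_self])
qed measurable

lemma classical_imp_gauged:
  assumes "classical_dnls \<omega> c f g"
  shows "gauged_dnls \<omega> c (\<lambda>x. cis (- c / 2 * x) * f x) (\<lambda>x. cis (- c / 2 * x) * (g x - \<i> * of_real (c / 2) * f x))"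
  unfolding gauged_dnls_def
proof (intro conjI allI)
  from assms have f: "(f has_vector_derivative g x) (at x)"
    and g: "(g has_vector_derivative dnls_second \<omega> c (f x) (g x)) (at x)"
    and int: "integrable lborel (\<lambda>x. (cmod (f x))\<^sup>2)" "integrable lborel (\<lambda>x. (cmod (g x))\<^sup>2)" for x
    by (auto simp: classical_dnls_def)
  define h where "h x = cis (- c / 2 * x) * f x" for x
  define k where "k x = cis (- c / 2 * x) * (g x - \<i> * of_real (c / 2) * f x)" for x
  have fh: "f x = cis (c / 2 * x) * h x" for x
    by (simp add: h_def mult.assoc[symmetric] cis_mult)
  have gk: "g x = cis (c / 2 * x) * (k x + \<i> * of_real (c / 2) * h x)" for x
    by (simp add: h_def k_def mult.assoc[symmetric] cis_mult distrib_left)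
  note cis' = cis_vector_derivative[of "- c / 2"]
  show "((\<lambda>x. cis (- c / 2 * x) * f x) has_vector_derivative
      cis (- c / 2 * x) * (g x - \<i> * of_real (c / 2) * f x)) (at x)" for x
    by (rule has_vector_derivative_eq_rhs[OF has_vector_derivative_mult[OF cis' f]]) (simp add: algebra_simps)
  fix x
  have "(k has_vector_derivative cis (- c / 2 * x) * (dnls_second \<omega> c (f x) (g x) - \<i> * of_real (c / 2) * g x)
      + \<i> * of_real (- c / 2) * cis (- c / 2 * x) * (g x - \<i> * of_real (c / 2) * f x)) (at x)"
    unfolding k_def
    by (rule has_vector_derivative_mult[OF cis' has_vector_derivative_diff[OF g has_vector_derivative_mult_right[OF f]]])
  moreover have "cis (- c / 2 * x) * (dnls_second \<omega> c (f x) (g x) - \<i> * of_real (c / 2) * g x)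
      + \<i> * of_real (- c / 2) * cis (- c / 2 * x) * (g x - \<i> * of_real (c / 2) * f x)
    = of_real (dnls_potential \<omega> c ((cmod (h x))\<^sup>2) + Im (cnj (h x) * k x)) * h x"
  proof -
    define Q where "Q = complex_of_real (dnls_potential \<omega> c ((cmod (h x))\<^sup>2) + Im (cnj (h x) * k x))"
    have cc: "cis (- c / 2 * x) * (cis (c / 2 * x) * v) = v" for v
      by (simp add: mult.assoc[symmetric] cis_mult)
    have 1: "dnls_second \<omega> c (f x) (g x) = cis (c / 2 * x) * (Q * h x + \<i> * of_real c * k x - of_real (c\<^sup>2 / 4) * h x)"
      unfolding fh gk dnls_second_gauge Q_def ..
    \<comment> \<open>All terms are collected behind one factor \<open>cis (c / 2 * x)\<close>, so
      that the opposite phases cancel through \<open>cc\<close>; the terms with \<open>k\<close> and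
      with c^2/4 then cancel as well.\<close>
    have "cis (- c / 2 * x) * (dnls_second \<omega> c (f x) (g x) - \<i> * of_real (c / 2) * g x)
      + \<i> * of_real (- c / 2) * cis (- c / 2 * x) * (g x - \<i> * of_real (c / 2) * f x)
      = cis (- c / 2 * x) * (cis (c / 2 * x) * ((Q * h x + \<i> * of_real c * k x - of_real (c\<^sup>2 / 4) * h x)
         - \<i> * of_real (c / 2) * (k x + \<i> * of_real (c / 2) * h x) - \<i> * of_real (c / 2) * k x))"
      unfolding 1 unfolding fh gk by (simp add: algebra_simps)
    also have "\<dots> = Q * h x"
      unfolding cc by (simp add: algebra_simps power2_eq_square)
    finally show ?thesis by (simp add: Q_def)
  qed
  ultimately show "((\<lambda>x. cis (- c / 2 * x) * (g x - \<i> * of_real (c / 2) * f x)) has_vector_derivative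
      of_real (dnls_potential \<omega> c ((cmod (cis (- c / 2 * x) * f x))\<^sup>2) +
        Im (cnj (cis (- c / 2 * x) * f x) * (cis (- c / 2 * x) * (g x - \<i> * of_real (c / 2) * f x)))) *
      (cis (- c / 2 * x) * f x)) (at x)"
    by (simp only: h_def[abs_def] k_def[abs_def])
next
  from assms have int: "integrable lborel (\<lambda>x. (cmod (f x))\<^sup>2)" "integrable lborel (\<lambda>x. (cmod (g x))\<^sup>2)"
    by (auto simp: classical_dnls_def)
  show "integrable lborel (\<lambda>x. (cmod (cis (- c / 2 * x) * f x))\<^sup>2)"
    using int(1) by (simp add: norm_mult)
  note cont = classical_dnls_continuous[OF assms]
  have [measurable]: "f \<in> borel_measurable borel" "g \<in> borel_measurable borel"
    using cont by (auto intro: borel_measurable_continuous_onI)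
  from square_integrable_add[OF _ _ int(2,1), of "- \<i> * of_real (c / 2)"]
  have "integrable lborel (\<lambda>x. (cmod (g x - \<i> * of_real (c / 2) * f x))\<^sup>2)" by simp
  then show "integrable lborel (\<lambda>x. (cmod (cis (- c / 2 * x) * (g x - \<i> * of_real (c / 2) * f x)))\<^sup>2)"
    by (simp add: norm_mult)
qed

lemma gauged_imp_classical:
  assumes "gauged_dnls \<omega> c h k"
  shows "classical_dnls \<omega> c (\<lambda>x. cis (c / 2 * x) * h x) (\<lambda>x. cis (c / 2 * x) * (k x + \<i> * of_real (c / 2) * h x))"
  unfolding classical_dnls_def
proof (intro conjI allI)
  from assms have h: "(h has_vector_derivative k x) (at x)"
    and k: "(k has_vector_derivative of_real (dnls_potential \<omega> c ((cmod (h x))\<^sup>2) + Im (cnj (h x) * k x)) * h x) (at x)"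
    and int: "integrable lborel (\<lambda>x. (cmod (h x))\<^sup>2)" "integrable lborel (\<lambda>x. (cmod (k x))\<^sup>2)" for x
    by (auto simp: gauged_dnls_def)
  note cis' = cis_vector_derivative[of "c / 2"]
  show "((\<lambda>x. cis (c / 2 * x) * h x) has_vector_derivative
      cis (c / 2 * x) * (k x + \<i> * of_real (c / 2) * h x)) (at x)" for x
    by (rule has_vector_derivative_eq_rhs[OF has_vector_derivative_mult[OF cis' h]]) (simp add: algebra_simps)
  show "((\<lambda>x. cis (c / 2 * x) * (k x + \<i> * of_real (c / 2) * h x)) has_vector_derivative
      dnls_second \<omega> c (cis (c / 2 * x) * h x) (cis (c / 2 * x) * (k x + \<i> * of_real (c / 2) * h x))) (at x)" for x
    by (rule has_vector_derivative_eq_rhs[OF has_vector_derivative_mult[OF cis' has_vector_derivative_add[OF k has_vector_derivative_mult_right[OF h]]]])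
     (unfold dnls_second_gauge, simp add: power2_eq_square algebra_simps, simp add: field_simps)
  show "integrable lborel (\<lambda>x. (cmod (cis (c / 2 * x) * h x))\<^sup>2)"
    using int(1) by (simp add: norm_mult)
  have "continuous_on UNIV h" "continuous_on UNIV k"
    using h k unfolding continuous_on_eq_continuous_at[OF open_UNIV]
    by (blast intro: has_vector_derivative_continuous)+
  then have [measurable]: "h \<in> borel_measurable borel" "k \<in> borel_measurable borel"
    by (auto intro: borel_measurable_continuous_onI)
  from square_integrable_add[OF _ _ int(2,1), of "\<i> * of_real (c / 2)"]
  have "integrable lborel (\<lambda>x. (cmod (k x + \<i> * of_real (c / 2) * h x))\<^sup>2)" by simp
  then show "integrable lborel (\<lambda>x. (cmod (cis (c / 2 * x) * (k x + \<i> * of_real (c / 2) * h x)))\<^sup>2)"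
    by (simp add: norm_mult)
qed

section \<open>Conservation laws of the gauged system\<close>

lemma DERIV_zero_const:
  fixes f :: "real \<Rightarrow> real"
  assumes "\<And>x. (f has_real_derivative 0) (at x)"
  obtains C where "\<And>x. f x = C"
  using DERIV_isconst_all[of f] assms by metis

text \<open>Otherwise the constant \<epsilon> > 0 would be integrable over the line. This does the
  work of boundary conditions at infinity.\<close>

lemma integrable_small_value:
  fixes F :: "real \<Rightarrow> real"
  assumes int: "integrable lborel F" and \<epsilon>: "0 < \<epsilon>"
  obtains x where "F x < \<epsilon>"
proof -
  have "\<exists>x. F x < \<epsilon>"
  proof (rule ccontr)
    assume "\<not> ?thesis"
    then have ge: "\<epsilon> \<le> F x" for x by (meson not_le)
    have "integrable lborel (\<lambda>x::real. \<epsilon>)"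
      using int by (rule Bochner_Integration.integrable_bound) (use ge \<epsilon> in \<open>auto intro: order_trans[OF _ abs_ge_self]\<close>)
    then show False using \<epsilon> by (simp add: integrable_iff_bounded ennreal_mult_top)
  qed
  with that show ?thesis by blast
qed

locale gauged_profile =
  fixes \<omega> c :: real and h k :: "real \<Rightarrow> complex"
  assumes gauged: "gauged_dnls \<omega> c h k"
begin

definition s :: "real \<Rightarrow> real" where "s x = (cmod (h x))\<^sup>2"
text \<open>Half of s'. Once the momentum is known to vanish, it is all of cnj h h'.\<close>

definition r :: "real \<Rightarrow> real" where "r x = Re (cnj (h x) * k x)"

text \<open>Chosen so that u P(u) is the antiderivative of \<open>dnls_potential\<close> that
  vanishes at u = 0.\<close>

definition P :: "real \<Rightarrow> real" where "P u = (\<omega> - c\<^sup>2 / 4) + c / 4 * u - u\<^sup>2 / 16"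

lemma h_deriv: "(h has_vector_derivative k x) (at x)"
  using gauged by (simp add: gauged_dnls_def)

lemma k_deriv0: "(k has_vector_derivative
    of_real (dnls_potential \<omega> c (s x) + Im (cnj (h x) * k x)) * h x) (at x)"
  using gauged by (simp add: gauged_dnls_def s_def)

lemma s_nonneg: "0 \<le> s x"
  by (simp add: s_def)

lemma s_deriv: "(s has_real_derivative 2 * r x) (at x)"
  unfolding s_def[abs_def] cmod_power2 r_def
  by (auto intro!: derivative_eq_intros h_deriv simp: algebra_simps)

lemma small_values:
  assumes "0 < \<epsilon>"
  obtains x where "s x + (cmod (k x))\<^sup>2 < \<epsilon>"
proof -
  have "integrable lborel (\<lambda>x. s x + (cmod (k x))\<^sup>2)"
    using gauged by (auto simp: gauged_dnls_def s_def)
  from integrable_small_value[OF this assms] that show ?thesis by blast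
qed

text \<open>Its derivative is Im(|k|^2 + q |h|^2) with a real q, hence 0, although q still contains
  the momentum. The constant is at most |h| |k| <= |h|^2 + |k|^2 in modulus, which is arbitrarily
  small somewhere.\<close>

lemma momentum_zero: "Im (cnj (h x) * k x) = 0"
proof -
  have "((\<lambda>x. Im (cnj (h x) * k x)) has_real_derivative 0) (at x)" for x
    by (auto intro!: derivative_eq_intros h_deriv k_deriv0 simp: algebra_simps)
  then obtain J where J: "\<And>x. Im (cnj (h x) * k x) = J"
    using DERIV_zero_const by blast
  have "\<bar>J\<bar> \<le> 0"
  proof (rule field_le_epsilon)
    fix \<epsilon> :: real assume "0 < \<epsilon>"
    then obtain x where x: "s x + (cmod (k x))\<^sup>2 < \<epsilon>" using small_values by blast
    have "\<bar>J\<bar> \<le> cmod (cnj (h x) * k x)"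
      using abs_Im_le_cmod J by metis
    also have "\<dots> = cmod (h x) * cmod (k x)" by (simp add: norm_mult)
    also have "\<dots> \<le> s x + (cmod (k x))\<^sup>2"
      using zero_le_power2[of "cmod (h x) - cmod (k x)"] zero_le_power2[of "cmod (h x)"] zero_le_power2[of "cmod (k x)"]
      unfolding s_def power2_diff by linarith
    finally show "\<bar>J\<bar> \<le> 0 + \<epsilon>" using x by simp
  qed
  then show ?thesis using J by simp
qed

lemma k_deriv: "(k has_vector_derivative of_real (dnls_potential \<omega> c (s x)) * h x) (at x)"
  using k_deriv0[of x] unfolding momentum_zero by simp

lemma cnj_h_k: "cnj (h x) * k x = of_real (r x)"
  by (simp add: complex_eq_iff r_def momentum_zero[simplified])

lemma energy: "(cmod (k x))\<^sup>2 = s x * P (s x)"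
proof -
  define E where "E x = (cmod (k x))\<^sup>2 - s x * P (s x)" for x
  have T: "((\<lambda>x. (cmod (k x))\<^sup>2) has_real_derivative 2 * dnls_potential \<omega> c (s x) * r x) (at x)" for x
    unfolding cmod_power2 r_def
    by (auto intro!: derivative_eq_intros k_deriv simp: algebra_simps)
  have sP: "((\<lambda>x. s x * P (s x)) has_real_derivative 2 * dnls_potential \<omega> c (s x) * r x) (at x)" for x
    unfolding P_def
    by (auto intro!: derivative_eq_intros s_deriv simp: dnls_potential_def field_simps power2_eq_square)
  have "(E has_real_derivative 0) (at x)" for x
    unfolding E_def[abs_def] by (rule DERIV_cong[OF DERIV_diff[OF T sP]]) simp
  then obtain C where C: "\<And>x. E x = C"
    using DERIV_zero_const by blast
  \<comment> \<open>K - 1 bounds |P(u)| for 0 <= u <= 1, and K >= 1 covers the term |k|^2, so |C| <=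
    K (s + |k|^2) wherever s <= 1.\<close>
  define K where "K = 2 + \<bar>\<omega> - c\<^sup>2 / 4\<bar> + \<bar>c\<bar>"
  have K: "K > 0" by (simp add: K_def)
  have "\<bar>C\<bar> \<le> 0"
  proof (rule field_le_epsilon)
    fix \<epsilon> :: real assume "0 < \<epsilon>"
    \<comment> \<open>The minimum with 1 secures s <= 1, the range in which the bound on P
      holds.\<close>
    with K have "0 < min 1 (\<epsilon> / K)" by simp
    then obtain x where x: "s x + (cmod (k x))\<^sup>2 < min 1 (\<epsilon> / K)" using small_values by blast
    have s: "0 \<le> s x" "s x \<le> 1" using x s_nonneg[of x] zero_le_power2[of "cmod (k x)"] by linarith+
    have s2: "(s x)\<^sup>2 \<le> 1" using s by (simp add: power_le_one)
    have "\<bar>P (s x)\<bar> \<le> \<bar>\<omega> - c\<^sup>2 / 4\<bar> + \<bar>c / 4 * s x\<bar> + \<bar>(s x)\<^sup>2 / 16\<bar>"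
      unfolding P_def by linarith
    also have "\<dots> \<le> \<bar>\<omega> - c\<^sup>2 / 4\<bar> + \<bar>c\<bar> * 1 + 1"
      using s s2 by (intro add_mono) (auto simp: abs_mult intro!: mult_mono)
    finally have P: "\<bar>P (s x)\<bar> \<le> K - 1" by (simp add: K_def)
    have "\<bar>C\<bar> \<le> (cmod (k x))\<^sup>2 + s x * \<bar>P (s x)\<bar>"
    proof -
      have "\<bar>s x * P (s x)\<bar> = s x * \<bar>P (s x)\<bar>" using s by (simp add: abs_mult)
      then show ?thesis using C[of x] zero_le_power2[of "cmod (k x)"] unfolding E_def by linarith
    qed
    also have "\<dots> \<le> (cmod (k x))\<^sup>2 + s x * (K - 1)"
      using P s by (intro add_mono mult_left_mono) auto
    also have "\<dots> \<le> K * (s x + (cmod (k x))\<^sup>2)"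
      using mult_nonneg_nonneg[of "K - 1" "(cmod (k x))\<^sup>2"] s by (simp add: K_def algebra_simps)
    also have "\<dots> \<le> K * (\<epsilon> / K)" using x K by (intro mult_left_mono) auto
    finally show "\<bar>C\<bar> \<le> 0 + \<epsilon>" using K by simp
  qed
  with C[of x] show ?thesis by (simp add: E_def)
qed

lemma r_squared: "(r x)\<^sup>2 = (s x)\<^sup>2 * P (s x)"
proof -
  have "(r x)\<^sup>2 = (cmod (cnj (h x) * k x))\<^sup>2"
    by (simp only: cnj_h_k norm_of_real power2_abs)
  also have "\<dots> = s x * (cmod (k x))\<^sup>2"
    by (simp add: norm_mult power_mult_distrib s_def)
  finally show ?thesis unfolding energy by (simp add: power2_eq_square)
qed

text \<open>Completing the square: P(u) = \<omega> - (u/4 - c/2)^2. This bound, uniform in u,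
  supplies the constant in the Gronwall estimate.\<close>

lemma P_le: "P u \<le> \<omega>"
  using zero_le_power2[of "u / 4 - c / 2"] by (simp add: P_def power2_eq_square algebra_simps)

lemma r_bound: "\<bar>r x\<bar> \<le> sqrt \<bar>\<omega>\<bar> * s x"
proof (rule power2_le_imp_le)
  have "(r x)\<^sup>2 \<le> (s x)\<^sup>2 * \<bar>\<omega>\<bar>"
    unfolding r_squared using P_le[of "s x"] by (intro mult_left_mono) auto
  then show "\<bar>r x\<bar>\<^sup>2 \<le> (sqrt \<bar>\<omega>\<bar> * s x)\<^sup>2"
    by (simp add: power_mult_distrib mult.commute)
qed (simp add: s_nonneg)

text \<open>Gronwall's argument, since $|s'| \le C s$ with a global constant $C$.\<close>

lemma vanishing:
  assumes "s x0 = 0"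
  shows "s x = 0"
proof -
  define C where "C = 2 * sqrt \<bar>\<omega>\<bar>"
  have b: "2 * r y \<le> C * s y" "- (C * s y) \<le> 2 * r y" for y
    using r_bound[of y] by (auto simp: C_def)
  have "s x \<le> 0"
  proof (cases "x0 \<le> x")
    case True
    have "s x * exp (- C * x) \<le> s x0 * exp (- C * x0)"
    proof (rule DERIV_nonpos_imp_nonincreasing[OF True])
      fix y
      have "((\<lambda>x. s x * exp (- C * x)) has_real_derivative (2 * r y - C * s y) * exp (- C * y)) (at y)"
        by (auto intro!: derivative_eq_intros s_deriv simp: algebra_simps)
      moreover have "(2 * r y - C * s y) * exp (- C * y) \<le> 0"
        using b(1)[of y] by (simp add: mult_nonpos_nonneg)
      ultimately show "\<exists>z. ((\<lambda>x. s x * exp (- C * x)) has_real_derivative z) (at y) \<and> z \<le> 0" by blast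
    qed
    then show ?thesis using assms by (simp add: mult_le_0_iff)
  next
    case False
    then have le: "x \<le> x0" by simp
    have "s x * exp (C * x) \<le> s x0 * exp (C * x0)"
    proof (rule DERIV_nonneg_imp_nondecreasing[OF le])
      fix y
      have "((\<lambda>x. s x * exp (C * x)) has_real_derivative (2 * r y + C * s y) * exp (C * y)) (at y)"
        by (auto intro!: derivative_eq_intros s_deriv simp: algebra_simps)
      moreover have "0 \<le> (2 * r y + C * s y) * exp (C * y)"
        using b(2)[of y] by simp
      ultimately show "\<exists>z. ((\<lambda>x. s x * exp (C * x)) has_real_derivative z) (at y) \<and> 0 \<le> z" by blast
    qed
    then show ?thesis using assms by (simp add: mult_le_0_iff)
  qed
  with s_nonneg[of x] show ?thesis by simp
qed

lemma no_positive_profile: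
  assumes "4 * \<omega> = c\<^sup>2 \<and> c \<le> 0 \<or> 4 * \<omega> < c\<^sup>2" and pos: "\<And>x. 0 < s x"
  shows False
proof -
  have P: "0 \<le> P (s x)" for x
    using r_squared[of x] pos[of x] zero_le_power2[of "r x"] by (simp add: zero_le_mult_iff)
  from assms(1) show False
  proof
    \<comment> \<open>Here P has no constant term and its linear term is nonpositive, so P is
      negative at every positive argument and any point will do.\<close>
    assume a: "4 * \<omega> = c\<^sup>2 \<and> c \<le> 0"
    have "c / 4 * s 0 \<le> 0" using a pos[of 0] by (simp add: mult_nonpos_nonneg)
    moreover have "0 < (s 0)\<^sup>2" using pos[of 0] by simp
    ultimately show False using P[of 0] conjunct1[OF a] unfolding P_def by linarith
  next
    assume a: "4 * \<omega> < c\<^sup>2"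
    \<comment> \<open>For s below this threshold the linear term c s cannot outweigh 4 \<omega> -
      c^2 < 0; the 1 in the denominator covers c = 0.\<close>
    define \<epsilon> where "\<epsilon> = (c\<^sup>2 - 4 * \<omega>) / (\<bar>c\<bar> + 1)"
    have \<epsilon>: "0 < \<epsilon>" using a by (simp add: \<epsilon>_def)
    obtain x where x: "s x + (cmod (k x))\<^sup>2 < \<epsilon>" using small_values[OF \<epsilon>] by blast
    then have x: "s x < \<epsilon>" using zero_le_power2[of "cmod (k x)"] by linarith
    have "c * s x \<le> \<bar>c\<bar> * s x" using pos[of x] by (intro mult_right_mono) auto
    also have "\<dots> \<le> \<bar>c\<bar> * \<epsilon>" using x by (intro mult_left_mono) auto
    also have "\<dots> \<le> (\<bar>c\<bar> + 1) * \<epsilon>" using \<epsilon> by (intro mult_right_mono) auto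
    also have "\<dots> = c\<^sup>2 - 4 * \<omega>" by (simp add: \<epsilon>_def)
    finally have "4 * P (s x) + (s x)\<^sup>2 / 4 \<le> 0" by (simp add: P_def algebra_simps)
    moreover have "0 < (s x)\<^sup>2" using pos[of x] by simp
    ultimately show False using P[of x] by simp
  qed
qed

section \<open>The reciprocal density and its linear equation\<close>

definition w :: "real \<Rightarrow> real" where "w x = 1 / s x"
definition z :: "real \<Rightarrow> real" where "z x = - 2 * r x / (s x)\<^sup>2"

text \<open>The product rule yields |k|^2 plus a potential term, and the energy identity makes this
  a function of s alone, which closes the equation for w.\<close>

lemma r_deriv: "(r has_real_derivative s x * P (s x) + dnls_potential \<omega> c (s x) * s x) (at x)"
proof -
  have "(r has_real_derivative (cmod (k x))\<^sup>2 + dnls_potential \<omega> c (s x) * s x) (at x)"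
    unfolding r_def[abs_def] cmod_power2 
    by (auto intro!: derivative_eq_intros h_deriv k_deriv simp: s_def cmod_power2) (simp add: algebra_simps power2_eq_square)
  then show ?thesis by (simp only: energy)
qed

context
  assumes pos: "\<And>x. 0 < s x"
begin

lemma w_pos: "0 < w x"
  using pos by (simp add: w_def)

lemma w_deriv: "(w has_real_derivative z x) (at x)"
  unfolding w_def[abs_def] z_def
  using pos[of x] by (auto intro!: derivative_eq_intros s_deriv simp: power2_eq_square)

text \<open>Formally this is \<open>z_squared\<close> differentiated and divided by 2 z, but the
  division fails where z = 0. Computed directly, z' is (6 P - 2 V)/s with V the potential, and there
  the s^2 terms cancel.\<close>

lemma z_deriv: "(z has_real_derivative (4 * \<omega> - c\<^sup>2) * w x + c / 2) (at x)"
proof -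
  have ne: "s x \<noteq> 0" using pos[of x] by simp
  have "(z has_real_derivative (- 2 * (s x * P (s x) + dnls_potential \<omega> c (s x) * s x) * (s x)\<^sup>2
      - (- 2 * r x) * (2 * s x * (2 * r x))) / ((s x)\<^sup>2 * (s x)\<^sup>2)) (at x)"
    unfolding z_def[abs_def]
    by (rule DERIV_cong[OF DERIV_divide[OF DERIV_cmult[OF r_deriv] DERIV_power[OF s_deriv]]])
      (use ne in \<open>simp_all add: algebra_simps\<close>)
  also have "(- 2 * (s x * P (s x) + dnls_potential \<omega> c (s x) * s x) * (s x)\<^sup>2
      - (- 2 * r x) * (2 * s x * (2 * r x))) = 
     (- 2 * (s x * P (s x) + dnls_potential \<omega> c (s x) * s x) * (s x)\<^sup>2 + 8 * s x * (r x)\<^sup>2)"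
    by (simp add: power2_eq_square)
  also have "\<dots> / ((s x)\<^sup>2 * (s x)\<^sup>2) = (4 * \<omega> - c\<^sup>2) * w x + c / 2"
    unfolding r_squared P_def dnls_potential_def w_def
    using ne by (simp add: divide_simps power2_eq_square) (simp add: algebra_simps)
  finally show ?thesis .
qed

lemma z_squared: "(z x)\<^sup>2 = (4 * \<omega> - c\<^sup>2) * (w x)\<^sup>2 + c * w x - 1 / 4"
proof -
  have ne: "s x \<noteq> 0" using pos[of x] by simp
  have "(z x)\<^sup>2 = 4 * (r x)\<^sup>2 / ((s x)\<^sup>2)\<^sup>2"
    by (simp add: z_def power_divide power_mult_distrib)
  also have "\<dots> = (4 * \<omega> - c\<^sup>2) * (w x)\<^sup>2 + c * w x - 1 / 4"
    unfolding r_squared P_def w_def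
    using ne by (simp add: divide_simps power2_eq_square)
  finally show ?thesis .
qed

end

text \<open>\<open>h * sqrt w\<close> is h/|h|. As cnj h h' is real and equal to r, one has h' =
  (r/s) h, so h and |h| have the same logarithmic derivative and their quotient is a unimodular
  constant.\<close>

lemma constant_phase:
  assumes pos: "\<And>x. 0 < s x"
  obtains \<theta> where "\<And>x. h x = cis \<theta> * of_real (1 / sqrt (w x))"
proof -
  have wp: "0 < w x" for x using w_pos[OF pos] .
  have "((\<lambda>x. h x * of_real (sqrt (w x))) has_vector_derivative 0) (at x)" for x
  proof -
    have "((\<lambda>x. sqrt (w x)) has_real_derivative z x / (2 * sqrt (w x))) (at x)"
      using wp[of x] by (auto intro!: derivative_eq_intros w_deriv[OF pos] simp: field_simps)
    from has_vector_derivative_mult[OF h_deriv has_vector_derivative_of_real[OF this]]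
    have "((\<lambda>x. h x * of_real (sqrt (w x))) has_vector_derivative
       h x * of_real (z x / (2 * sqrt (w x))) + k x * of_real (sqrt (w x))) (at x)" .
    moreover have "h x * of_real (z x / (2 * sqrt (w x))) + k x * of_real (sqrt (w x)) = 0"
    proof -
      have hr: "h x * of_real (r x) = of_real (s x) * k x"
        unfolding cnj_h_k[symmetric] s_def mult.assoc[symmetric] complex_norm_square ..
      have "z x / (2 * sqrt (w x)) = - (r x / s x) * sqrt (w x)"
      proof -
        have "sqrt (w x) * sqrt (w x) = 1 / s x" using wp[of x] by (simp add: w_def)
        then show ?thesis
          using wp[of x] pos[of x] by (simp add: z_def field_simps power2_eq_square)
      qed
      then have "h x * of_real (z x / (2 * sqrt (w x))) = - (h x * of_real (r x)) / of_real (s x) * of_real (sqrt (w x))"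
        by simp
      also have "\<dots> = - (k x * of_real (sqrt (w x)))"
        unfolding hr using pos[of x] by simp
      finally show ?thesis by simp
    qed
    ultimately show ?thesis by simp
  qed
  then obtain u where u: "\<And>x. h x * of_real (sqrt (w x)) = u"
    using has_vector_derivative_zero_constant[of UNIV "\<lambda>x. h x * of_real (sqrt (w x))"] by auto
  have "cmod u = 1"
  proof -
    have "cmod u = cmod (h 0) * sqrt (w 0)" using wp[of 0] u[of 0, symmetric] by (simp add: norm_mult)
    also have "\<dots> = 1" using pos[of 0] by (simp add: w_def s_def real_sqrt_divide)
    finally show ?thesis .
  qed
  then have "cis (Arg u) = u" using rcis_cmod_Arg[of u] by (simp add: rcis_def)
  moreover have "h x = u * of_real (1 / sqrt (w x))" for x
    using u[of x] wp[of x] by (auto simp: field_simps)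
  ultimately show ?thesis using that by metis
qed

end

section \<open>Solitons and uniqueness\<close>

definition soliton_regime :: "real \<Rightarrow> real \<Rightarrow> bool" where
  "soliton_regime \<omega> c \<longleftrightarrow> 4 * \<omega> > c\<^sup>2 \<or> 4 * \<omega> = c\<^sup>2 \<and> c > 0"

text \<open>The reciprocal of the squared amplitude.\<close>

definition inv_density :: "real \<Rightarrow> real \<Rightarrow> real \<Rightarrow> real" where
  "inv_density \<omega> c x = (if 4 * \<omega> > c\<^sup>2
     then sqrt \<omega> / (4 * \<omega> - c\<^sup>2) * (cosh (sqrt (4 * \<omega> - c\<^sup>2) * x) - c / (2 * sqrt \<omega>))
     else (c\<^sup>2 * x\<^sup>2 + 1) / (4 * c))"

definition inv_density' :: "real \<Rightarrow> real \<Rightarrow> real \<Rightarrow> real" where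
  "inv_density' \<omega> c x = (if 4 * \<omega> > c\<^sup>2
     then sqrt \<omega> / sqrt (4 * \<omega> - c\<^sup>2) * sinh (sqrt (4 * \<omega> - c\<^sup>2) * x)
     else c / 2 * x)"

lemma subcritical_bounds:
  fixes \<omega> c :: real
  assumes "4 * \<omega> > c\<^sup>2"
  shows "0 < \<omega>" "\<bar>c\<bar> / (2 * sqrt \<omega>) < 1"
proof -
  show \<omega>: "0 < \<omega>" using assms zero_le_power2[of c] by linarith
  have "\<bar>c\<bar> < 2 * sqrt \<omega>"
    by (rule power2_less_imp_less) (use assms \<omega> in \<open>auto simp: power_mult_distrib\<close>)
  then show "\<bar>c\<bar> / (2 * sqrt \<omega>) < 1" using \<omega> by (simp add: divide_less_eq)
qed

text \<open>For y >= 0 this averages exp y >= 1 + y + y^2/2 and exp(-y) >= 1 - y; the crude second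
  bound accounts for 1/4 in place of 1/2.\<close>

lemma cosh_ge_quadratic: "1 + x\<^sup>2 / 4 \<le> cosh (x::real)"
proof -
  have "1 + y\<^sup>2 / 4 \<le> cosh y" if "0 \<le> y" for y :: real
    using exp_lower_Taylor_quadratic[OF that] exp_ge_add_one_self[of "-y"] by (simp add: cosh_def)
  from this[of "\<bar>x\<bar>"] show ?thesis by (cases "0 \<le> x") simp_all
qed

text \<open>One quadratic bound serves both regimes and two purposes: positivity, and integrability
  of the reciprocal by comparison with 1/(1 + x^2). In the critical regime quadratic growth is the
  true rate.\<close>

lemma inv_density_lower_bound:
  assumes "soliton_regime \<omega> c"
  obtains m where "0 < m" "\<And>x. m * (1 + x\<^sup>2) \<le> inv_density \<omega> c x"
proof (cases "4 * \<omega> > c\<^sup>2")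
  case True
  define A where "A = sqrt \<omega> / (4 * \<omega> - c\<^sup>2)"
  define B where "B = c / (2 * sqrt \<omega>)"
  define \<kappa> where "\<kappa> = sqrt (4 * \<omega> - c\<^sup>2)"
  have A: "0 < A" using True subcritical_bounds(1)[OF True] by (simp add: A_def)
  \<comment> \<open>|c| < 2 sqrt \<omega> keeps the subtracted constant below 1, the minimum of
    cosh.\<close>
  have B: "0 < 1 - B"
  proof -
    have "B \<le> \<bar>c\<bar> / (2 * sqrt \<omega>)"
      unfolding B_def using subcritical_bounds(1)[OF True] by (intro divide_right_mono) auto
    then show ?thesis using subcritical_bounds(2)[OF True] by simp
  qed
  have \<kappa>: "0 < \<kappa>" using True by (simp add: \<kappa>_def)
  define m where "m = min (1 - B) (\<kappa>\<^sup>2 / 4)"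
  have "A * m * (1 + x\<^sup>2) \<le> inv_density \<omega> c x" for x
  proof -
    have "m * (1 + x\<^sup>2) = m + m * x\<^sup>2" by (simp add: algebra_simps)
    also have "\<dots> \<le> (1 - B) + \<kappa>\<^sup>2 / 4 * x\<^sup>2"
      unfolding m_def by (intro add_mono mult_right_mono min.cobounded1 min.cobounded2) simp
    also have "\<dots> \<le> cosh (\<kappa> * x) - B"
      using cosh_ge_quadratic[of "\<kappa> * x"] by (simp add: power_mult_distrib)
    finally have "A * (m * (1 + x\<^sup>2)) \<le> A * (cosh (\<kappa> * x) - B)"
      using A by (intro mult_left_mono) auto
    then show ?thesis using True by (simp add: inv_density_def A_def B_def \<kappa>_def mult.assoc)
  qed
  moreover have "0 < A * m" using A B \<kappa> by (simp add: m_def)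
  ultimately show ?thesis using that by blast
next
  case False
  then have c: "0 < c" using assms by (simp add: soliton_regime_def)
  define m where "m = min (1 / (4 * c)) (c / 4)"
  have "m * (1 + x\<^sup>2) \<le> inv_density \<omega> c x" for x
  proof -
    have "m * (1 + x\<^sup>2) = m + m * x\<^sup>2" by (simp add: algebra_simps)
    also have "\<dots> \<le> 1 / (4 * c) + c / 4 * x\<^sup>2"
      by (intro add_mono mult_right_mono) (auto simp: m_def)
    also have "\<dots> = inv_density \<omega> c x"
      using False c by (simp add: inv_density_def field_simps power2_eq_square)
    finally show ?thesis .
  qed
  moreover have "0 < m" using c by (simp add: m_def)
  ultimately show ?thesis using that by blast
qed

lemma inv_density_pos:
  assumes "soliton_regime \<omega> c"
  shows "0 < inv_density \<omega> c x"
proof -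
  obtain m where "0 < m" "m * (1 + x\<^sup>2) \<le> inv_density \<omega> c x"
    using inv_density_lower_bound[OF assms] by metis
  moreover have "0 < m * (1 + x\<^sup>2)" using \<open>0 < m\<close> by (simp add: add_pos_nonneg)
  ultimately show ?thesis by linarith
qed

lemma inv_density_deriv: "(inv_density \<omega> c has_real_derivative inv_density' \<omega> c x) (at x)"
proof (cases "4 * \<omega> > c\<^sup>2")
  case True
  define \<kappa> where "\<kappa> = sqrt (4 * \<omega> - c\<^sup>2)"
  have \<kappa>: "\<kappa> > 0" "4 * \<omega> - c\<^sup>2 = \<kappa> * \<kappa>" using True by (simp_all add: \<kappa>_def)
  have "((\<lambda>x. sqrt \<omega> / (\<kappa> * \<kappa>) * (cosh (\<kappa> * x) - c / (2 * sqrt \<omega>))) has_real_derivative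
      sqrt \<omega> / (\<kappa> * \<kappa>) * (sinh (\<kappa> * x) * \<kappa> - 0)) (at x)"
    by (intro DERIV_cmult DERIV_diff DERIV_const) (auto intro!: derivative_eq_intros)
  with \<kappa> True show ?thesis
    unfolding inv_density_def[abs_def] inv_density'_def by (simp flip: \<kappa>_def)
next
  case False
  then show ?thesis
    unfolding inv_density_def[abs_def] inv_density'_def
    by (cases "c = 0") (auto intro!: derivative_eq_intros simp: field_simps power2_eq_square)
qed

lemma inv_density'_deriv:
  assumes "soliton_regime \<omega> c"
  shows "(inv_density' \<omega> c has_real_derivative (4 * \<omega> - c\<^sup>2) * inv_density \<omega> c x + c / 2) (at x)"
proof (cases "4 * \<omega> > c\<^sup>2")
  case True
  define \<kappa> where "\<kappa> = sqrt (4 * \<omega> - c\<^sup>2)"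
  have \<kappa>: "\<kappa> > 0" "4 * \<omega> - c\<^sup>2 = \<kappa> * \<kappa>" using True by (simp_all add: \<kappa>_def)
  have "((\<lambda>x. sqrt \<omega> / \<kappa> * sinh (\<kappa> * x)) has_real_derivative sqrt \<omega> / \<kappa> * (cosh (\<kappa> * x) * \<kappa>)) (at x)"
    by (intro DERIV_cmult) (auto intro!: derivative_eq_intros)
  moreover have "sqrt \<omega> / \<kappa> * (cosh (\<kappa> * x) * \<kappa>)
     = (\<kappa> * \<kappa>) * (sqrt \<omega> / (\<kappa> * \<kappa>) * (cosh (\<kappa> * x) - c / (2 * sqrt \<omega>))) + c / 2"
    using \<kappa>(1) subcritical_bounds(1)[OF True] by (simp add: field_simps)
  ultimately show ?thesis
    using True \<kappa> unfolding inv_density_def inv_density'_def[abs_def] by (simp flip: \<kappa>_def)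
next
  case False
  then have "4 * \<omega> = c\<^sup>2" using assms by (simp add: soliton_regime_def)
  then show ?thesis
    unfolding inv_density'_def[abs_def] by (auto intro!: derivative_eq_intros)
qed

lemma inv_density'_squared:
  assumes "soliton_regime \<omega> c"
  shows "(inv_density' \<omega> c x)\<^sup>2 = (4 * \<omega> - c\<^sup>2) * (inv_density \<omega> c x)\<^sup>2 + c * inv_density \<omega> c x - 1 / 4"
proof (cases "4 * \<omega> > c\<^sup>2")
  case True
  define K where "K = 4 * \<omega> - c\<^sup>2"
  define q where "q = sqrt \<omega>"
  define C where "C = cosh (sqrt K * x)"
  have K: "0 < K" and q: "0 < q" and \<omega>: "\<omega> = q\<^sup>2"
    using True subcritical_bounds(1)[OF True] by (auto simp: K_def q_def)
  have c2: "c\<^sup>2 = 4 * q\<^sup>2 - K" using \<omega> by (simp add: K_def)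
  have "(inv_density' \<omega> c x)\<^sup>2 = q\<^sup>2 / K * (C\<^sup>2 - 1)"
    using True K by (simp add: inv_density'_def power_mult_distrib power_divide sinh_square_eq K_def q_def[symmetric] C_def)
  also have "\<dots> = K * (q / K * (C - c / (2 * q)))\<^sup>2 + c * (q / K * (C - c / (2 * q))) - 1 / 4"
  proof -
    \<comment> \<open>The terms linear in C cancel, so c survives only through c^2, which
      \<open>c2\<close> eliminates.\<close>
    have "K * (q / K * (C - c / (2 * q)))\<^sup>2 + c * (q / K * (C - c / (2 * q))) - 1 / 4
       = (q\<^sup>2 * C\<^sup>2 - c\<^sup>2 / 4) / K - 1 / 4"
      using K q by (simp add: divide_simps power2_eq_square) (simp add: algebra_simps)
    also have "\<dots> = q\<^sup>2 / K * (C\<^sup>2 - 1)"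
      unfolding c2 using K by (simp add: field_simps)
    finally show ?thesis by simp
  qed
  finally show ?thesis
    using True by (simp add: inv_density_def K_def q_def C_def)
next
  case False
  then have "4 * \<omega> = c\<^sup>2" "0 < c" using assms by (simp_all add: soliton_regime_def)
  then show ?thesis
    using False by (simp add: inv_density'_def inv_density_def field_simps power2_eq_square)
qed

lemma inv_density'_surj:
  assumes "soliton_regime \<omega> c"
  obtains y where "inv_density' \<omega> c y = v"
proof (cases "4 * \<omega> > c\<^sup>2")
  case True
  define \<kappa> where "\<kappa> = sqrt (4 * \<omega> - c\<^sup>2)"
  have \<kappa>: "0 < \<kappa>" "0 < sqrt \<omega>" using True subcritical_bounds(1)[OF True] by (auto simp: \<kappa>_def)
  have "inv_density' \<omega> c (arsinh (v * \<kappa> / sqrt \<omega>) / \<kappa>) = v"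
    using True \<kappa> by (simp add: inv_density'_def \<kappa>_def[symmetric])
  with that show ?thesis by blast
next
  case False
  then have "inv_density' \<omega> c (2 * v / c) = v"
    using assms by (simp add: inv_density'_def soliton_regime_def)
  with that show ?thesis by blast
qed

section \<open>Uniqueness for the reciprocal density\<close>

text \<open>The operator D'' - \<kappa>^2 D factors into two first-order ones: E - \<kappa> D solves
  F' = - \<kappa> F, and then D' = \<kappa> D. Each is settled by an integrating factor, and
  \<kappa> = 0 is included for the critical regime.\<close>

lemma linear_oscillator_zero:
  fixes D E :: "real \<Rightarrow> real"
  assumes D: "\<And>x. (D has_real_derivative E x) (at x)"
    and E: "\<And>x. (E has_real_derivative \<kappa>\<^sup>2 * D x) (at x)"
    and zero: "D 0 = 0" "E 0 = 0"
  shows "D x = 0"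
proof -
  have "((\<lambda>x. (E x - \<kappa> * D x) * exp (\<kappa> * x)) has_real_derivative 0) (at x)" for x
    by (auto intro!: derivative_eq_intros D E simp: algebra_simps power2_eq_square)
  then have "(E x - \<kappa> * D x) * exp (\<kappa> * x) = (E 0 - \<kappa> * D 0) * exp (\<kappa> * 0)" for x
    by (intro DERIV_isconst_all) blast
  then have ED: "E x = \<kappa> * D x" for x
    using zero by simp
  have "((\<lambda>x. D x * exp (- \<kappa> * x)) has_real_derivative 0) (at x)" for x
    by (auto intro!: derivative_eq_intros D simp: algebra_simps ED)
  then have "D x * exp (- \<kappa> * x) = D 0 * exp (- \<kappa> * 0)"
    by (intro DERIV_isconst_all) blast
  then show ?thesis using zero by simp
qed

text \<open>For K > 0 this is Vieta: the roots of K X^2 + c X - e have product - e/K < 0. Arguing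
  from two distinct positive roots to e = - K a b covers K = 0 as well.\<close>

lemma first_integral_root_unique:
  fixes K c a b e :: real
  assumes "0 \<le> K" "0 < a" "0 < b" "0 < e" "K * a\<^sup>2 + c * a = e" "K * b\<^sup>2 + c * b = e"
  shows "a = b"
proof (rule ccontr)
  assume ne: "a \<noteq> b"
  have "(a - b) * (K * (a + b) + c) = 0"
    using assms(5,6) by (simp add: algebra_simps power2_eq_square)
  with ne have "c = - K * (a + b)" by simp
  with assms(5) have "e = - (K * (a * b))" by (simp add: algebra_simps power2_eq_square)
  moreover have "0 \<le> K * (a * b)" using assms by simp
  ultimately show False using \<open>0 < e\<close> by simp
qed

text \<open>A translate of the soliton matches $w'$ at $0$; it then also matches $w$ there, because the first
  integral leaves only one positive value for $w$.\<close>

lemma inv_density_unique: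
  assumes reg: "soliton_regime \<omega> c" and pos: "\<And>x. 0 < w x"
    and w: "\<And>x. (w has_real_derivative z x) (at x)"
    and z: "\<And>x. (z has_real_derivative (4 * \<omega> - c\<^sup>2) * w x + c / 2) (at x)"
    and sq: "\<And>x. (z x)\<^sup>2 = (4 * \<omega> - c\<^sup>2) * (w x)\<^sup>2 + c * w x - 1 / 4"
  obtains x0 where "\<And>x. w x = inv_density \<omega> c (x - x0)"
proof -
  obtain y where y: "inv_density' \<omega> c y = z 0"
    using inv_density'_surj[OF reg] by blast
  have K: "0 \<le> 4 * \<omega> - c\<^sup>2" using reg by (auto simp: soliton_regime_def)
  have y0: "inv_density \<omega> c y = w 0"
  proof (rule first_integral_root_unique[OF K inv_density_pos[OF reg] pos])
    show "0 < (z 0)\<^sup>2 + 1 / 4" by (simp add: add_nonneg_pos)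
    show "(4 * \<omega> - c\<^sup>2) * (inv_density \<omega> c y)\<^sup>2 + c * inv_density \<omega> c y = (z 0)\<^sup>2 + 1 / 4"
      using inv_density'_squared[OF reg, of y] y by simp
    show "(4 * \<omega> - c\<^sup>2) * (w 0)\<^sup>2 + c * w 0 = (z 0)\<^sup>2 + 1 / 4" using sq[of 0] by simp
  qed
  \<comment> \<open>Both functions solve the same linear equation with inhomogeneity c/2, so their
    difference solves the homogeneous one, with zero data at 0.\<close>
  have "w x - inv_density \<omega> c (x + y) = 0" for x
  proof (rule linear_oscillator_zero[where D="\<lambda>x. w x - inv_density \<omega> c (x + y)" and E="\<lambda>x. z x - inv_density' \<omega> c (x + y)" and \<kappa>="sqrt (4 * \<omega> - c\<^sup>2)"])
    fix x
    show "((\<lambda>x. w x - inv_density \<omega> c (x + y)) has_real_derivative z x - inv_density' \<omega> c (x + y)) (at x)"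
      by (rule DERIV_diff[OF w DERIV_shift[THEN iffD1, OF inv_density_deriv]])
    have "((\<lambda>x. z x - inv_density' \<omega> c (x + y)) has_real_derivative
       ((4 * \<omega> - c\<^sup>2) * w x + c / 2) - ((4 * \<omega> - c\<^sup>2) * inv_density \<omega> c (x + y) + c / 2)) (at x)"
      by (rule DERIV_diff[OF z DERIV_shift[THEN iffD1, OF inv_density'_deriv[OF reg]]])
    then show "((\<lambda>x. z x - inv_density' \<omega> c (x + y)) has_real_derivative
       (sqrt (4 * \<omega> - c\<^sup>2))\<^sup>2 * (w x - inv_density \<omega> c (x + y))) (at x)"
      using K by (simp add: algebra_simps)
  qed (use y y0 in simp_all)
  then have "w x = inv_density \<omega> c (x - (- y))" for x by simp
  with that show ?thesis by blast
qed

section \<open>The soliton is a solution\<close>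

lemma amplitude_eq:
  assumes "soliton_regime \<omega> c"
  shows "amplitude \<omega> c x = 1 / sqrt (inv_density \<omega> c x)"
proof (cases "4 * \<omega> > c\<^sup>2")
  case True
  then show ?thesis
    using inv_density_pos[OF assms, of x]
    by (simp add: amplitude_def inv_density_def powr_minus_divide powr_half_sqrt)
next
  case False
  then have c: "4 * \<omega> = c\<^sup>2" "0 < c" using assms by (simp_all add: soliton_regime_def)
  have p: "0 < c\<^sup>2 * x\<^sup>2 + 1" by (simp add: add_nonneg_pos)
  have "sqrt (4 * c) = 2 * sqrt c" by (simp add: real_sqrt_mult)
  with False c p show ?thesis
    by (simp add: amplitude_def inv_density_def powr_minus_divide powr_half_sqrt real_sqrt_divide)
qed

lemma soliton_eq:
  assumes "soliton_regime \<omega> c"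
  shows "soliton \<omega> c x = cis (c / 2 * x) * of_real (1 / sqrt (inv_density \<omega> c x))"
  by (simp add: soliton_def amplitude_eq[OF assms] cis_conv_exp)

lemma integrable_inverse_quadratic: "integrable lborel (\<lambda>x::real. inverse (1 + x\<^sup>2))"
  using integrable_inverse_1_plus_square by (simp add: set_integrable_def)

text \<open>The differential equation follows from the second-order equation of
  \<open>inv_density\<close> and its first integral, without the explicit formulas, so both regimes
  are verified at once. The profile is real, hence its momentum vanishes.\<close>

lemma gauged_soliton:
  assumes reg: "soliton_regime \<omega> c"
  shows "gauged_dnls \<omega> c (\<lambda>x. of_real (1 / sqrt (inv_density \<omega> c x)))
    (\<lambda>x. of_real (- inv_density' \<omega> c x / (2 * inv_density \<omega> c x * sqrt (inv_density \<omega> c x))))"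
proof -
  define v where "v = inv_density \<omega> c"
  define v' where "v' = inv_density' \<omega> c"
  have pos: "0 < v x" for x using inv_density_pos[OF reg] by (simp add: v_def)
  have d: "(v has_real_derivative v' x) (at x)" for x
    using inv_density_deriv by (simp add: v_def v'_def)
  have d': "(v' has_real_derivative (4 * \<omega> - c\<^sup>2) * v x + c / 2) (at x)" for x
    using inv_density'_deriv[OF reg] by (simp add: v_def v'_def)
  have sq: "(v' x)\<^sup>2 = (4 * \<omega> - c\<^sup>2) * (v x)\<^sup>2 + c * v x - 1 / 4" for x
    using inv_density'_squared[OF reg] by (simp add: v_def v'_def)
  have ds: "((\<lambda>x. sqrt (v x)) has_real_derivative v' x / (2 * sqrt (v x))) (at x)" for x
    using pos[of x] by (auto intro!: derivative_eq_intros d simp: field_simps)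
  have p: "((\<lambda>x. 1 / sqrt (v x)) has_real_derivative - v' x / (2 * v x * sqrt (v x))) (at x)" for x
    by (rule DERIV_cong[OF DERIV_divide[OF DERIV_const ds]])
      (use pos[of x] in \<open>auto simp: field_simps\<close>)
  have q: "((\<lambda>x. - v' x / (2 * v x * sqrt (v x))) has_real_derivative
     dnls_potential \<omega> c ((cmod (of_real (1 / sqrt (v x))))\<^sup>2) * (1 / sqrt (v x))) (at x)" for x
  proof -
    define u where "u = sqrt (v x)"
    have u: "0 < u" "v x = u\<^sup>2" using pos[of x] by (auto simp: u_def)
    have "((\<lambda>x. 2 * v x * sqrt (v x)) has_real_derivative 2 * v' x * u + v' x / (2 * u) * (2 * v x)) (at x)"
      unfolding u_def by (intro DERIV_mult DERIV_cmult d ds)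
    then have "((\<lambda>x. - v' x / (2 * v x * sqrt (v x))) has_real_derivative
       ((- ((4 * \<omega> - c\<^sup>2) * v x + c / 2)) * (2 * v x * u) - (- v' x) * (2 * v' x * u + v' x / (2 * u) * (2 * v x)))
        / (2 * v x * u * (2 * v x * u))) (at x)"
      unfolding u_def by (intro DERIV_divide DERIV_minus d') (use pos[of x] in auto)
    moreover have "((- ((4 * \<omega> - c\<^sup>2) * v x + c / 2)) * (2 * v x * u) - (- v' x) * (2 * v' x * u + v' x / (2 * u) * (2 * v x)))
        / (2 * v x * u * (2 * v x * u)) = 
        ((- ((4 * \<omega> - c\<^sup>2) * v x + c / 2)) * (2 * v x) + 3 * (v' x)\<^sup>2) * u / (4 * (v x)\<^sup>2 * u\<^sup>2)"
      using u(1) unfolding u(2) by (simp add: field_simps power2_eq_square)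
    moreover have "\<dots> = dnls_potential \<omega> c (1 / v x) * (1 / u)"
      unfolding sq dnls_potential_def u(2) using u(1)
      by (simp add: divide_simps power2_eq_square) (simp add: algebra_simps)
    moreover have "(cmod (of_real (1 / sqrt (v x))))\<^sup>2 = 1 / v x"
      using pos[of x] by (simp add: norm_divide power_divide)
    ultimately show ?thesis by (simp only: u_def)
  qed
  obtain m where m: "0 < m" "\<And>x. m * (1 + x\<^sup>2) \<le> v x"
    using inv_density_lower_bound[OF reg] unfolding v_def by metis
  have cont: "continuous_on UNIV v" "continuous_on UNIV v'"
    using d d' by (auto simp: continuous_on_eq_continuous_at intro: DERIV_isCont)
  then have [measurable]: "v \<in> borel_measurable borel" "v' \<in> borel_measurable borel"
    by (auto intro: borel_measurable_continuous_onI)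
  have int: "integrable lborel (\<lambda>x. 1 / v x)"
  proof (rule Bochner_Integration.integrable_bound)
    show "integrable lborel (\<lambda>x::real. 1 / m * inverse (1 + x\<^sup>2))"
      using integrable_inverse_quadratic by simp
    have "1 / v x \<le> 1 / m * inverse (1 + x\<^sup>2)" for x
    proof -
      have "0 < m * (1 + x\<^sup>2)" using m(1) by (simp add: add_pos_nonneg)
      then have "1 / v x \<le> 1 / (m * (1 + x\<^sup>2))" using m(2)[of x] by (intro divide_left_mono) (auto simp: pos)
      then show ?thesis by (simp add: divide_inverse)
    qed
    then show "AE x in lborel. norm (1 / v x) \<le> norm (1 / m * inverse (1 + x\<^sup>2))"
      using pos m(1) by (auto simp: less_imp_le)
  qed measurable
  have int': "integrable lborel (\<lambda>x. (- v' x / (2 * v x * sqrt (v x)))\<^sup>2)"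
  proof (rule Bochner_Integration.integrable_bound)
    show "integrable lborel (\<lambda>x. \<omega> * (1 / v x))" by (rule integrable_mult_right[OF int])
    have "(- v' x / (2 * v x * sqrt (v x)))\<^sup>2 \<le> \<omega> * (1 / v x)" for x
    proof -
      have "(- v' x / (2 * v x * sqrt (v x)))\<^sup>2 = (v' x)\<^sup>2 / (4 * (v x)\<^sup>2 * v x)"
        using pos[of x] by (simp add: power_divide power_mult_distrib)
      \<comment> \<open>This is the energy identity s P(s) at s = 1/v, with P in completed-square
        form, so the derivative inherits square integrability from the profile.\<close>
      also have "\<dots> = (\<omega> - (1 / (4 * v x) - c / 2)\<^sup>2) * (1 / v x)"
        unfolding sq using pos[of x]
        by (simp add: divide_simps power2_eq_square) (simp add: algebra_simps)
      also have "\<dots> \<le> \<omega> * (1 / v x)"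
        using pos[of x] by (intro mult_right_mono) auto
      finally show ?thesis .
    qed
    then show "AE x in lborel. norm ((- v' x / (2 * v x * sqrt (v x)))\<^sup>2) \<le> norm (\<omega> * (1 / v x))"
      by (intro AE_I2) (simp only: real_norm_def abs_power2 order_trans[OF _ abs_ge_self])
  qed measurable
  have "gauged_dnls \<omega> c (\<lambda>x. of_real (1 / sqrt (v x))) (\<lambda>x. of_real (- v' x / (2 * v x * sqrt (v x))))"
    unfolding gauged_dnls_def
  proof (intro conjI allI)
    fix x
    show "((\<lambda>x. complex_of_real (1 / sqrt (v x))) has_vector_derivative of_real (- v' x / (2 * v x * sqrt (v x)))) (at x)"
      by (rule has_vector_derivative_of_real[OF p])
    have "Im (cnj (complex_of_real (1 / sqrt (v x))) * complex_of_real (- v' x / (2 * v x * sqrt (v x)))) = 0"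
      by (simp only: complex_cnj_complex_of_real of_real_mult[symmetric] Im_complex_of_real)
    then show "((\<lambda>x. complex_of_real (- v' x / (2 * v x * sqrt (v x)))) has_vector_derivative
          of_real (dnls_potential \<omega> c ((cmod (of_real (1 / sqrt (v x))))\<^sup>2) +
            Im (cnj (of_real (1 / sqrt (v x))) * of_real (- v' x / (2 * v x * sqrt (v x))))) *
          of_real (1 / sqrt (v x))) (at x)"
      using has_vector_derivative_of_real[OF q, of x] by (simp only: add_0_right of_real_mult)
  next
    have "(cmod (of_real (1 / sqrt (v x))))\<^sup>2 = 1 / v x" for x
      using pos[of x] by (simp add: norm_divide power_divide)
    then show "integrable lborel (\<lambda>x. (cmod (of_real (1 / sqrt (v x))))\<^sup>2)" using int by simp
    show "integrable lborel (\<lambda>x. (cmod (of_real (- v' x / (2 * v x * sqrt (v x)))))\<^sup>2)"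
      using int' by (simp only: norm_of_real power2_abs)
  qed
  then show ?thesis by (simp only: v_def v'_def)
qed

lemma soliton_nontrivial_solution:
  assumes reg: "soliton_regime \<omega> c"
  shows "nontrivial_solution \<omega> c (soliton \<omega> c)"
  unfolding nontrivial_solution_def
proof
  have "soliton \<omega> c = (\<lambda>x. cis (c / 2 * x) * of_real (1 / sqrt (inv_density \<omega> c x)))"
    using soliton_eq[OF reg] by auto
  then show "dnls_profile_solution \<omega> c (soliton \<omega> c)"
    using classical_dnls_profile_solution[OF gauged_imp_classical[OF gauged_soliton[OF reg]]] by simp
  have "soliton \<omega> c x \<noteq> 0" for x
    using inv_density_pos[OF reg, of x] by (simp add: soliton_eq[OF reg])
  then show "\<not> (AE x in lebesgue. soliton \<omega> c x = 0)"
    by (simp add: AE_lebesgue_iff eventually_False ae_filter_eq_bot_iff)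
qed

section \<open>From weak solutions to the three cases\<close>

text \<open>A single zero of h would force s to vanish identically by \<open>vanishing\<close>, and
  \<phi> would be zero almost everywhere. Nontriviality thus becomes pointwise, and 1/s makes sense
  everywhere.\<close>

lemma nontrivial_solution_gauged:
  assumes "nontrivial_solution \<omega> c \<phi>"
  obtains h k where "gauged_dnls \<omega> c h k" "\<And>x. h x \<noteq> 0" "AE x in lebesgue. \<phi> x = cis (c / 2 * x) * h x"
proof -
  obtain f g where fg: "classical_dnls \<omega> c f g" and \<phi>: "AE x in lebesgue. \<phi> x = f x"
    using assms dnls_profile_regularity unfolding nontrivial_solution_def by metis
  define h where "h x = cis (- c / 2 * x) * f x" for x
  define k where "k x = cis (- c / 2 * x) * (g x - \<i> * of_real (c / 2) * f x)" for x
  have hk: "gauged_dnls \<omega> c h k"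
    using classical_imp_gauged[OF fg] by (simp only: h_def[abs_def] k_def[abs_def])
  interpret gauged_profile \<omega> c h k by unfold_locales (rule hk)
  have fh: "f x = cis (c / 2 * x) * h x" for x
    by (simp add: h_def mult.assoc[symmetric] cis_mult)
  have "h x \<noteq> 0" for x
  proof
    assume "h x = 0"
    then have "s x = 0" by (simp add: s_def)
    then have "s y = 0" for y by (rule vanishing)
    then have "f y = 0" for y by (simp add: fh s_def)
    with \<phi> assms show False by (simp add: nontrivial_solution_def)
  qed
  with hk \<phi> that[of h k] show ?thesis by (simp add: fh)
qed

lemma soliton_unique:
  assumes reg: "soliton_regime \<omega> c" and sol: "nontrivial_solution \<omega> c \<phi>"
  obtains \<theta> x0 :: real where "AE x in lebesgue. \<phi> x = exp (\<i> * of_real \<theta>) * soliton \<omega> c (x - x0)"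
proof -
  obtain h k where hk: "gauged_dnls \<omega> c h k" "\<And>x. h x \<noteq> 0" and \<phi>: "AE x in lebesgue. \<phi> x = cis (c / 2 * x) * h x"
    using nontrivial_solution_gauged[OF sol] by blast
  interpret gauged_profile \<omega> c h k by unfold_locales (rule hk)
  have pos: "0 < s x" for x using hk(2) by (simp add: s_def)
  obtain x0 where x0: "\<And>x. w x = inv_density \<omega> c (x - x0)"
    using inv_density_unique[OF reg w_pos[OF pos] w_deriv[OF pos] z_deriv[OF pos] z_squared[OF pos]] by blast
  obtain \<theta> where \<theta>: "\<And>x. h x = cis \<theta> * of_real (1 / sqrt (w x))"
    using constant_phase[OF pos] by blast
  have "cis (c / 2 * x) * h x = exp (\<i> * of_real (\<theta> + c / 2 * x0)) * soliton \<omega> c (x - x0)" for x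
  proof -
    \<comment> \<open>Translation by \<open>x0\<close> also shifts the gauge phase of the soliton by
      - c/2 \<open>x0\<close>, which the constant phase compensates.\<close>
    have "cis (c / 2 * x) * cis \<theta> = cis (\<theta> + c / 2 * x0) * cis (c / 2 * (x - x0))"
      by (simp add: cis_mult algebra_simps diff_divide_distrib)
    then have "cis (c / 2 * x) * h x = cis (\<theta> + c / 2 * x0) * soliton \<omega> c (x - x0)"
      unfolding \<theta> x0 soliton_eq[OF reg] mult.assoc[symmetric] by simp
    then show ?thesis by (simp only: cis_conv_exp)
  qed
  with \<phi> that[of "\<theta> + c / 2 * x0" x0] show ?thesis by (simp only:)
qed

lemma soliton_unique_up_to_symmetries:
  assumes "soliton_regime \<omega> c"
  shows "unique_up_to_symmetries \<omega> c (soliton \<omega> c)"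
  unfolding unique_up_to_symmetries_def
  using soliton_nontrivial_solution[OF assms] soliton_unique[OF assms] by metis

lemma no_nontrivial_solution:
  assumes "4 * \<omega> = c\<^sup>2 \<and> c \<le> 0 \<or> 4 * \<omega> < c\<^sup>2"
  shows "\<not> nontrivial_solution \<omega> c \<phi>"
proof
  assume "nontrivial_solution \<omega> c \<phi>"
  then obtain h k where hk: "gauged_dnls \<omega> c h k" "\<And>x. h x \<noteq> 0"
    using nontrivial_solution_gauged by blast
  interpret gauged_profile \<omega> c h k by unfold_locales (rule hk)
  show False
    by (rule no_positive_profile[OF assms]) (simp add: s_def hk(2))
qed

theorem theorem1p2:
  fixes \<omega> c :: real
  shows "(4 * \<omega> > c\<^sup>2 \<longrightarrow> unique_up_to_symmetries \<omega> c (soliton \<omega> c)) \<and>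
         (4 * \<omega> = c\<^sup>2 \<and> c > 0 \<longrightarrow> unique_up_to_symmetries \<omega> c (soliton \<omega> c)) \<and>
         ((4 * \<omega> = c\<^sup>2 \<and> c \<le> 0) \<or> 4 * \<omega> < c\<^sup>2 \<longrightarrow> (\<nexists>\<phi>. nontrivial_solution \<omega> c \<phi>))"
  using soliton_unique_up_to_symmetries no_nontrivial_solution
  by (auto simp: soliton_regime_def)

end
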